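(* Let $N\ge1$ be an integer, $a>0$, and let $A$ be the doubly infinite tridiagonal Jacobi matrix with diagonal entries $a_j=a\cos(2j\pi/N)$, $j\in\mathbb{Z}$, and all off-diagonal entries (directly above and below the diagonal) equal to $1/2$. Let $P_n$, $P_n^*$, $g_N$ be as in the context and let $\xi_1<\xi_2\le\xi_3<\xi_4\le\cdots\le\xi_{2N-1}<\xi_{2N}$ be the roots (counting multiplicity) of $g_N^2(x)=1$. Then the spectral measure $(d\mu_{ij})_{i,j\in\{0,1\}}$ of $A$ is absolutely continuous and given by $$\frac{d\mu_{00}(x)}{dx}=\frac{|P_N^*(x)|}{2\pi\sqrt{1-g_N^2(x)}},\qquad \frac{d\mu_{01}(x)}{dx}=\frac{(x-a)|P_N^*(x)|}{2\pi\sqrt{1-g_N^2(x)}},\qquad \frac{d\mu_{11}(x)}{dx}=\frac{|P_{N-1}(x)|}{\pi\sqrt{1-g_N^2(x)}}$$ for $x\in\bigcup_{k=1}^N(\xi_{2k-1},\xi_{2k})$ (these intervals carrying the measures).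
   Context: Let $q=e^{2\pi i/N}$, so $a(q^n+q^{-n})=2a\cos(2\pi n/N)$. The polynomials $P_n(x)$ are defined by $P_0(x)=1$, $P_1(x)=2x-2a$ and $$2xP_n(x)=P_{n+1}(x)+a(q^n+q^{-n})P_n(x)+P_{n-1}(x),\quad n\ge1.$$ The numerator polynomials $P_n^*(x)$ are defined by the same recurrence for $n\ge 1$ with $P_0^*(x)=0$ and $P_1^*(x)=2$. The polynomial $$g_N(x)=\frac{P_N(x)-P_{N-1}^*(x)/2}{2}$$ has degree $N$; the $2N$ roots of $g_N^2(x)=1$ are all real and can be ordered as in the claim. $A$ acts on $\ell^2(\mathbb{Z})$ with standard basis $(e_n)_{n\in\mathbb{Z}}$ by $Ae_n=\tfrac12e_{n-1}+a_ne_n+\tfrac12e_{n+1}$ and is self-adjoint. Its spectral measure is the symmetric $2\times2$ matrix of (finite real) measures $(\mu_{ij})_{i,j\in\{0,1\}}$, $\mu_{01}=\mu_{10}$, determined by $$\int_{\mathbb{R}}\frac{d\mu_{ij}(x)}{z-x}=\langle e_i,(zI-A)^{-1}e_j\rangle,\quad z\in\mathbb{C}\setminus\mathbb{R},\ i,j\in\{0,1\}.$$ *)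

theory Defs
  imports "HOL-Analysis.Analysis" "HOL-Computational_Algebra.Polynomial"
begin

subsection \<open>The Jacobi matrix as an operator on square-summable sequences\<close>

definition ell2 :: "(int \<Rightarrow> complex) set" where
  "ell2 = {f. (\<lambda>n. (cmod (f n))\<^sup>2) summable_on UNIV}"

definition ell2_inner :: "(int \<Rightarrow> complex) \<Rightarrow> (int \<Rightarrow> complex) \<Rightarrow> complex" where
  "ell2_inner f g = (\<Sum>\<^sub>\<infinity>n. cnj (f n) * g n)"

definition ebasis :: "int \<Rightarrow> int \<Rightarrow> complex" where
  "ebasis i = (\<lambda>n. if n = i then 1 else 0)"

definition matrix_op :: "(int \<Rightarrow> int \<Rightarrow> real) \<Rightarrow> (int \<Rightarrow> complex) \<Rightarrow> (int \<Rightarrow> complex)" where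
  "matrix_op M f = (\<lambda>m. \<Sum>\<^sub>\<infinity>n. complex_of_real (M m n) * f n)"

definition jacobi_diag :: "real \<Rightarrow> nat \<Rightarrow> int \<Rightarrow> real" where
  "jacobi_diag a N j = a * cos (2 * real_of_int j * pi / real N)"

definition jacobi_matrix :: "real \<Rightarrow> nat \<Rightarrow> int \<Rightarrow> int \<Rightarrow> real" where
  "jacobi_matrix a N m n =
     (if m = n then jacobi_diag a N n else if \<bar>m - n\<bar> = 1 then 1/2 else 0)"

definition jacobi_op :: "real \<Rightarrow> nat \<Rightarrow> (int \<Rightarrow> complex) \<Rightarrow> (int \<Rightarrow> complex)" where
  "jacobi_op a N = matrix_op (jacobi_matrix a N)"

lemma jacobi_op_apply:
  "jacobi_op a N f m =
     1/2 * f (m - 1) + complex_of_real (jacobi_diag a N m) * f m + 1/2 * f (m + 1)"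
proof -
  have "jacobi_op a N f m =
      (\<Sum>\<^sub>\<infinity>n\<in>{m - 1, m, m + 1}. complex_of_real (jacobi_matrix a N m n) * f n)"
    unfolding jacobi_op_def matrix_op_def
    by (rule infsum_cong_neutral) (auto simp: jacobi_matrix_def)
  also have "\<dots> = (\<Sum>n\<in>{m - 1, m, m + 1}. complex_of_real (jacobi_matrix a N m n) * f n)"
    by (rule infsum_finite) simp
  finally show ?thesis
    by (simp add: jacobi_matrix_def)
qed

lemma jacobi_op_ebasis:
  "jacobi_op a N (ebasis n) =
     (\<lambda>m. 1/2 * ebasis (n - 1) m + complex_of_real (jacobi_diag a N n) * ebasis n m
          + 1/2 * ebasis (n + 1) m)"
  by (rule ext) (auto simp: jacobi_op_apply ebasis_def)

text \<open>The resolvent \<open>(zI - T)\<inverse>\<close>, the inverse being that of \<open>zI - T\<close> as a map on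
  \<^const>\<open>ell2\<close>; it is meaningful whenever this map is a bijection of \<^const>\<open>ell2\<close>, in particular
  for self-adjoint \<open>T\<close> and non-real \<open>z\<close>.\<close>

definition resolvent ::
  "((int \<Rightarrow> complex) \<Rightarrow> (int \<Rightarrow> complex)) \<Rightarrow> complex \<Rightarrow> (int \<Rightarrow> complex) \<Rightarrow> (int \<Rightarrow> complex)" where
  "resolvent T z = the_inv_into ell2 (\<lambda>u n. z * u n - T u n)"


subsection \<open>Finite real (signed) Borel measures\<close>

text \<open>A finite real measure is a set function whose values off the Borel sets are irrelevant.\<close>

definition finite_real_measure :: "(real set \<Rightarrow> real) \<Rightarrow> bool" where
  "finite_real_measure \<nu> \<longleftrightarrow>
     (\<forall>F :: nat \<Rightarrow> real set. range F \<subseteq> sets borel \<longrightarrow> disjoint_family F \<longrightarrow>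
        (\<lambda>n. \<nu> (F n)) sums \<nu> (\<Union>n. F n))"

text \<open>\<open>Q\<close> and \<open>R\<close> are the positive and the negative part of \<open>\<nu>\<close>, concentrated on a Borel set \<open>H\<close>
  and on its complement.\<close>

definition jordan_decomposition ::
  "(real set \<Rightarrow> real) \<Rightarrow> real measure \<Rightarrow> real measure \<Rightarrow> bool" where
  "jordan_decomposition \<nu> Q R \<longleftrightarrow>
     finite_measure Q \<and> finite_measure R \<and> sets Q = sets borel \<and> sets R = sets borel \<and>
     (\<exists>H \<in> sets borel. measure Q (- H) = 0 \<and> measure R H = 0) \<and>
     (\<forall>E \<in> sets borel. \<nu> E = measure Q E - measure R E)"

definition has_real_measure_integral ::
  "(real set \<Rightarrow> real) \<Rightarrow> (real \<Rightarrow> complex) \<Rightarrow> complex \<Rightarrow> bool" where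
  "has_real_measure_integral \<nu> f I \<longleftrightarrow>
     (\<exists>Q R. jordan_decomposition \<nu> Q R \<and> integrable Q f \<and> integrable R f \<and>
            I = integral\<^sup>L Q f - integral\<^sup>L R f)"

text \<open>\<open>\<nu>\<close> is absolutely continuous with respect to Lebesgue measure and \<open>d\<nu>/dx = \<rho>\<close>.\<close>

definition absolutely_continuous_with_density ::
  "(real set \<Rightarrow> real) \<Rightarrow> (real \<Rightarrow> real) \<Rightarrow> bool" where
  "absolutely_continuous_with_density \<nu> \<rho> \<longleftrightarrow>
     integrable lborel \<rho> \<and> (\<forall>E \<in> sets borel. \<nu> E = (LINT x:E|lborel. \<rho> x))"

definition is_spectral_measure ::
  "((int \<Rightarrow> complex) \<Rightarrow> (int \<Rightarrow> complex)) \<Rightarrow> (int \<Rightarrow> int \<Rightarrow> real set \<Rightarrow> real) \<Rightarrow> bool" where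
  "is_spectral_measure T \<mu> \<longleftrightarrow>
     (\<forall>i \<in> {0, 1}. \<forall>j \<in> {0, 1}.
        finite_real_measure (\<mu> i j) \<and>
        (\<forall>E \<in> sets borel. \<mu> i j E = \<mu> j i E) \<and>
        (\<forall>z. z \<notin> \<real> \<longrightarrow>
           has_real_measure_integral (\<mu> i j) (\<lambda>x. 1 / (z - complex_of_real x))
             (ell2_inner (ebasis i) (resolvent T z (ebasis j)))))"


subsection \<open>The polynomials\<close>

text \<open>The recurrence is solved for its top term; with \<open>q = exp (2 \<pi> i / N)\<close> the coefficient
  \<open>a (q ^ n + q ^ -n)\<close> is \<open>2 * jacobi_diag a N n\<close>.\<close>

fun Ppoly :: "real \<Rightarrow> nat \<Rightarrow> nat \<Rightarrow> real poly" where
  "Ppoly a N 0 = 1"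
| "Ppoly a N (Suc 0) = [:- 2 * a, 2:]"
| "Ppoly a N (Suc (Suc n)) =
     [:- 2 * jacobi_diag a N (int (Suc n)), 2:] * Ppoly a N (Suc n) - Ppoly a N n"

fun Pstar :: "real \<Rightarrow> nat \<Rightarrow> nat \<Rightarrow> real poly" where
  "Pstar a N 0 = 0"
| "Pstar a N (Suc 0) = [:2:]"
| "Pstar a N (Suc (Suc n)) =
     [:- 2 * jacobi_diag a N (int (Suc n)), 2:] * Pstar a N (Suc n) - Pstar a N n"

definition gN_poly :: "real \<Rightarrow> nat \<Rightarrow> real poly" where
  "gN_poly a N = smult (1/2) (Ppoly a N N - smult (1/2) (Pstar a N (N - 1)))"

end

theory Submission
  imports Defs "HOL-Computational_Algebra.Fundamental_Theorem_Algebra"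
begin

text \<open>
  Let \<open>c\<close> and \<open>s\<close> be the solutions of \<open>u (n + 1) + u (n - 1) = 2 (z - b_n) u n\<close> that are even and
  odd in \<open>n\<close>, for an even \<open>N\<close>-periodic potential \<open>b\<close>. Their monodromy is
  \<open>c (n + N) = g c n + D s n\<close>, \<open>s (n + N) = s_N c n + g s n\<close> with \<open>g\<^sup>2 - 1 = D s_N\<close>, and the
  decaying solution \<open>c + m s\<close> has \<open>m\<^sup>2 = D / s_N\<close>. It gives the resolvent entries
  \<open>G_00 = - 1 / m\<close>, \<open>G_01 = (z - b_0) G_00 - 1\<close> and \<open>G_11 = (z - b_0)\<^sup>2 G_00 + m\<close>. Hence
  \<open>G_00\<^sup>2 = s_N\<^sup>2 / (g\<^sup>2 - 1)\<close> and \<open>G_11\<^sup>2 = p_{N-1}\<^sup>2 / (g\<^sup>2 - 1)\<close> with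
  \<open>p = c + (z - b_0) s\<close>; since \<open>Im G_jj \<le> 0\<close> in the upper half plane, this determines the boundary
  values of \<open>Im G\<close> on the real line without choosing branches of the square root, and Stieltjes
  inversion turns them into densities.

  No singular part arises, not even at closed gaps: \<open>D\<close> and \<open>s_N\<close> have no nonreal roots, as a
  Floquet solution with unimodular multiplier carries the same current through both ends of a
  period, and their roots are simple by the confluent Christoffel--Darboux formula. So
  \<open>\<bar>D\<bar>\<close> and \<open>\<bar>s_N\<bar>\<close> to the power \<open>- 1/2\<close> are locally integrable, and they dominate \<open>G\<close>
  near the real line.
\<close>

section \<open>Three-term recurrences over a commutative ring\<close>

text \<open>Over the ring of real polynomials, with \<open>z\<close> the indeterminate, the solutions are the
  orthogonal polynomials themselves; over the real and the complex numbers they are their values.\<close>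

definition is_solution :: "(int \<Rightarrow> 'a::comm_ring_1) \<Rightarrow> 'a \<Rightarrow> (int \<Rightarrow> 'a) \<Rightarrow> bool" where
  "is_solution b z u \<longleftrightarrow> (\<forall>n. u (n + 1) + u (n - 1) = 2 * (z - b n) * u n)"

lemma solution_succ: "is_solution b z u \<Longrightarrow> u (n + 1) = 2 * (z - b n) * u n - u (n - 1)"
  unfolding is_solution_def by (metis add_diff_cancel_right')

lemma solution_Suc_Suc:
  assumes "is_solution b z u"
  shows "u (int (Suc (Suc n))) = 2 * (z - b (int (Suc n))) * u (int (Suc n)) - u (int n)"
  using solution_succ[OF assms, of "int (Suc n)"] by (simp add: add.commute)

lemma solution_pred: "is_solution b z u \<Longrightarrow> u (n - 1) = 2 * (z - b n) * u n - u (n + 1)"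
  unfolding is_solution_def by (metis add_diff_cancel_left')

lemma solution_eqI:
  assumes u: "is_solution b z u" and v: "is_solution b z v" and init: "u 0 = v 0" "u 1 = v 1"
  shows "u n = v n"
proof -
  have "u n = v n \<and> u (n + 1) = v (n + 1)"
  proof (induction n rule: int_induct[where k = 0])
    case (step1 i)
    then show ?case using solution_succ[OF u, of "i + 1"] solution_succ[OF v, of "i + 1"] by simp
  next
    case (step2 i)
    then show ?case using solution_pred[OF u, of i] solution_pred[OF v, of i] by simp
  qed (use init in auto)
  then show ?thesis by simp
qed

lemma is_solution_linear_combination:
  assumes u: "is_solution b z u" and v: "is_solution b z v"
  shows "is_solution b z (\<lambda>n. c * u n + d * v n)"
  unfolding is_solution_def by (simp add: solution_succ[OF u] solution_succ[OF v] algebra_simps)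

lemma is_solution_shift:
  assumes "\<And>n. b (n + k) = b n" "is_solution b z u"
  shows "is_solution b z (\<lambda>n. u (n + k))"
  unfolding is_solution_def
proof
  fix n :: int
  have "n + 1 + k = n + k + 1" "n - 1 + k = n + k - 1" by simp_all
  then show "u (n + 1 + k) + u (n - 1 + k) = 2 * (z - b n) * u (n + k)"
    using assms by (simp only: is_solution_def)
qed

lemma is_solution_reflect:
  assumes "\<And>n. b (- n) = b n" "is_solution b z u"
  shows "is_solution b z (\<lambda>n. u (- n))"
  unfolding is_solution_def
proof
  fix n :: int
  have "- (n + 1) = - n - 1" "- (n - 1) = - n + 1" by simp_all
  then show "u (- (n + 1)) + u (- (n - 1)) = 2 * (z - b n) * u (- n)"
    using solution_succ[OF assms(2), of "- n"] by (simp add: assms(1))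
qed

definition wronskian :: "(int \<Rightarrow> 'a::comm_ring_1) \<Rightarrow> (int \<Rightarrow> 'a) \<Rightarrow> int \<Rightarrow> 'a" where
  "wronskian u v n = u n * v (n + 1) - u (n + 1) * v n"

lemma wronskian_eq_wronskian_0:
  assumes u: "is_solution b z u" and v: "is_solution b z v"
  shows "wronskian u v n = wronskian u v 0"
proof -
  have step: "wronskian u v n = wronskian u v (n - 1)" for n
    unfolding wronskian_def solution_succ[OF u, of n] solution_succ[OF v, of n]
    by (simp add: algebra_simps)
  show ?thesis
  proof (induction n rule: int_induct[where k = 0])
    case (step1 i)
    then show ?case using step[of "i + 1"] by simp
  next
    case (step2 i)
    then show ?case using step[of i] by simp
  qed simp
qed

fun forward_solution :: "(nat \<Rightarrow> 'a::comm_ring_1) \<Rightarrow> 'a \<Rightarrow> 'a \<Rightarrow> 'a \<Rightarrow> nat \<Rightarrow> 'a" where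
  "forward_solution b z c d 0 = c"
| "forward_solution b z c d (Suc 0) = d"
| "forward_solution b z c d (Suc (Suc n)) =
     2 * (z - b (Suc n)) * forward_solution b z c d (Suc n) - forward_solution b z c d n"

definition ivp_solution :: "(int \<Rightarrow> 'a::comm_ring_1) \<Rightarrow> 'a \<Rightarrow> 'a \<Rightarrow> 'a \<Rightarrow> int \<Rightarrow> 'a" where
  "ivp_solution b z c d n =
     (if n \<ge> 0 then forward_solution (\<lambda>k. b (int k)) z c d (nat n)
      else forward_solution (\<lambda>k. b (- int k)) z c (2 * (z - b 0) * c - d) (nat (- n)))"

lemma ivp_solution_init [simp]: "ivp_solution b z c d 0 = c" "ivp_solution b z c d 1 = d"
  by (simp_all add: ivp_solution_def)

lemma is_solution_ivp_solution: "is_solution b z (ivp_solution b z c d)"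
  unfolding is_solution_def
proof
  fix n :: int
  consider k where "n = int (Suc k)" | "n = 0" | k where "n = - int (Suc k)"
    by (metis int_cases3 not0_implies_Suc of_nat_0 neg_0_equal_iff_equal)
  then show "ivp_solution b z c d (n + 1) + ivp_solution b z c d (n - 1) =
      2 * (z - b n) * ivp_solution b z c d n"
  proof cases
    case (1 k)
    then have "nat (n + 1) = Suc (Suc k)" "nat n = Suc k" "nat (n - 1) = k" by auto
    then show ?thesis by (simp add: ivp_solution_def 1)
  next
    case 2
    then show ?thesis by (simp add: ivp_solution_def)
  next
    case (3 k)
    then have "nat (- (n - 1)) = Suc (Suc k)" "nat (- n) = Suc k" "nat (- (n + 1)) = k" by auto
    then show ?thesis by (cases k) (simp_all add: ivp_solution_def 3 numeral_2_eq_2)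
  qed
qed

definition even_sol :: "(int \<Rightarrow> 'a::comm_ring_1) \<Rightarrow> 'a \<Rightarrow> int \<Rightarrow> 'a" where
  "even_sol b z = ivp_solution b z 1 (z - b 0)"

definition odd_sol :: "(int \<Rightarrow> 'a::comm_ring_1) \<Rightarrow> 'a \<Rightarrow> int \<Rightarrow> 'a" where
  "odd_sol b z = ivp_solution b z 0 1"

lemma even_sol_init [simp]: "even_sol b z 0 = 1" "even_sol b z 1 = z - b 0"
  and odd_sol_init [simp]: "odd_sol b z 0 = 0" "odd_sol b z 1 = 1"
  by (simp_all add: even_sol_def odd_sol_def)

lemma is_solution_even_sol: "is_solution b z (even_sol b z)"
  and is_solution_odd_sol: "is_solution b z (odd_sol b z)"
  by (simp_all add: even_sol_def odd_sol_def is_solution_ivp_solution)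

lemma solution_eq_even_odd:
  assumes "is_solution b z u"
  shows "u n = u 0 * even_sol b z n + (u 1 - (z - b 0) * u 0) * odd_sol b z n"
  by (rule solution_eqI[OF assms
        is_solution_linear_combination[OF is_solution_even_sol is_solution_odd_sol]])
    (simp_all add: algebra_simps)

locale comm_ring_hom =
  fixes h :: "'a::comm_ring_1 \<Rightarrow> 'b::comm_ring_1"
  assumes hom_add: "h (x + y) = h x + h y"
    and hom_mult: "h (x * y) = h x * h y"
    and hom_1: "h 1 = 1"
begin

lemma hom_0: "h 0 = 0"
  using hom_add[of 0 0] by simp

lemma hom_diff: "h (x - y) = h x - h y"
  using hom_add[of "x - y" y] by (simp add: algebra_simps)

lemma is_solution_hom:
  assumes "is_solution b z u"
  shows "is_solution (\<lambda>n. h (b n)) (h z) (\<lambda>n. h (u n))"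
proof -
  have "h 2 = 2"
    using hom_add[of 1 1] by (simp add: hom_1)
  then show ?thesis
    by (simp add: is_solution_def solution_succ[OF assms] hom_diff hom_mult)
qed

lemma even_sol_hom: "h (even_sol b z n) = even_sol (\<lambda>n. h (b n)) (h z) n"
  by (rule solution_eqI[OF is_solution_hom[OF is_solution_even_sol] is_solution_even_sol])
    (simp_all add: hom_1 hom_diff)

lemma odd_sol_hom: "h (odd_sol b z n) = odd_sol (\<lambda>n. h (b n)) (h z) n"
  by (rule solution_eqI[OF is_solution_hom[OF is_solution_odd_sol] is_solution_odd_sol])
    (simp_all add: hom_1 hom_0)

end

section \<open>The monodromy of an even periodic sequence\<close>

definition even_shift_coeff :: "(int \<Rightarrow> 'a::comm_ring_1) \<Rightarrow> nat \<Rightarrow> 'a \<Rightarrow> 'a" where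
  "even_shift_coeff b N z = even_sol b z (int N + 1) - (z - b 0) * even_sol b z (int N)"

locale even_periodic =
  fixes b :: "int \<Rightarrow> 'a::comm_ring_1" and N :: nat
  assumes period_pos: "N > 0"
    and even: "b (- n) = b n"
    and periodic: "b (n + int N) = b n"
begin

lemma even_sol_minus [simp]: "even_sol b z (- n) = even_sol b z n"
proof (rule solution_eqI[OF _ is_solution_even_sol])
  show "is_solution b z (\<lambda>n. even_sol b z (- n))"
    by (intro is_solution_reflect even is_solution_even_sol)
  show "even_sol b z (- 1) = even_sol b z 1"
    using solution_pred[OF is_solution_even_sol, of b z 0] by simp
qed simp

lemma odd_sol_minus [simp]: "odd_sol b z (- n) = - odd_sol b z n"
proof -
  have reflected: "is_solution b z (\<lambda>n. odd_sol b z (- n))"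
    by (intro is_solution_reflect even is_solution_odd_sol)
  have "odd_sol b z (- 1) = - 1"
    using solution_pred[OF is_solution_odd_sol, of b z 0] by (simp add: eq_neg_iff_add_eq_0)
  with solution_eq_even_odd[OF reflected, of n] show ?thesis by simp
qed

lemma even_sol_shift:
  "even_sol b z (n + int N) =
    even_sol b z (int N) * even_sol b z n + even_shift_coeff b N z * odd_sol b z n"
proof -
  have "is_solution b z (\<lambda>n. even_sol b z (n + int N))"
    by (intro is_solution_shift periodic is_solution_even_sol)
  from solution_eq_even_odd[OF this, of n] show ?thesis
    by (simp add: even_shift_coeff_def add.commute)
qed

text \<open>The Wronskian of the even solution and the shifted odd one, evaluated at \<open>0\<close> and at \<open>- N\<close>,
  shows that both diagonal entries of the monodromy matrix are \<open>even_sol b z N\<close>.\<close>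

lemma odd_sol_shift:
  "odd_sol b z (n + int N) =
    odd_sol b z (int N) * even_sol b z n + even_sol b z (int N) * odd_sol b z n"
proof -
  have shifted: "is_solution b z (\<lambda>n. odd_sol b z (n + int N))"
    by (intro is_solution_shift periodic is_solution_odd_sol)
  have "odd_sol b z (1 + int N) - (z - b 0) * odd_sol b z (int N) = even_sol b z (int N)"
    using wronskian_eq_wronskian_0[OF is_solution_even_sol shifted, of "- int N"]
    by (simp add: wronskian_def)
  then show ?thesis
    using solution_eq_even_odd[OF shifted, of n] by simp
qed

lemma even_sol_square_minus_1:
  "(even_sol b z (int N))\<^sup>2 - 1 = even_shift_coeff b N z * odd_sol b z (int N)"
  using even_sol_shift[of z "- int N"] by (simp add: power2_eq_square algebra_simps)

lemma odd_sol_pred_period: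
  "odd_sol b z (int N - 1) = (z - b 0) * odd_sol b z (int N) - even_sol b z (int N)"
  using odd_sol_shift[of z "- 1"] odd_sol_minus[of z 1] even_sol_minus[of z 1]
  by (simp add: mult.commute)

lemma even_sol_pred_period:
  "even_sol b z (int N - 1) = (z - b 0) * even_sol b z (int N) - even_shift_coeff b N z"
  using even_sol_shift[of z "- 1"] odd_sol_minus[of z 1] even_sol_minus[of z 1]
  by (simp add: mult.commute)

end

section \<open>Real polynomials\<close>

definition cpoly :: "real poly \<Rightarrow> complex \<Rightarrow> complex" where
  "cpoly p z = poly (map_poly of_real p) z"

lemma cpoly_0 [simp]: "cpoly 0 z = 0"
  by (simp add: cpoly_def)

lemma cpoly_pCons [simp]: "cpoly (pCons c p) z = of_real c + z * cpoly p z"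
  by (simp add: cpoly_def map_poly_pCons)

lemma cpoly_1 [simp]: "cpoly 1 z = 1"
  by (simp add: one_pCons)

lemma cpoly_add [simp]: "cpoly (p + q) z = cpoly p z + cpoly q z"
  by (induction p q rule: poly_induct2) (simp_all add: algebra_simps)

lemma cpoly_smult [simp]: "cpoly (smult c p) z = of_real c * cpoly p z"
  by (induction p) (simp_all add: algebra_simps)

lemma cpoly_mult [simp]: "cpoly (p * q) z = cpoly p z * cpoly q z"
  by (induction p) (simp_all add: algebra_simps)

lemma cpoly_of_real: "cpoly p (of_real x) = of_real (poly p x)"
  by (induction p) simp_all

lemma isCont_cpoly: "isCont (cpoly p) z"
  unfolding cpoly_def [abs_def] by simp

interpretation cpoly_hom: comm_ring_hom "\<lambda>p. cpoly p z" for z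
  by unfold_locales simp_all

interpretation poly_hom: comm_ring_hom "\<lambda>p. poly p x" for x :: "'a::comm_ring_1"
  by unfold_locales simp_all

lemma tendsto_cpoly_vertical:
  "((\<lambda>y. cpoly p (Complex x y)) \<longlongrightarrow> of_real (poly p x)) (at_right 0)"
proof -
  have "((\<lambda>y. Complex x y) \<longlongrightarrow> Complex x 0) (at_right 0)"
    by (intro tendsto_Complex tendsto_intros)
  then show ?thesis
    using isCont_tendsto_compose[OF isCont_cpoly, of "Complex x" "of_real x" "at_right 0" p]
    by (simp add: cpoly_of_real flip: complex_of_real_def)
qed

lemma cpoly_bounded_rectangle:
  obtains B where "\<And>x y. x \<in> {c..d} \<Longrightarrow> y \<in> {0<..1} \<Longrightarrow> cmod (cpoly p (Complex x y)) \<le> B"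
proof -
  let ?R = "cbox (Complex c 0) (Complex d 1)"
  have "compact (cpoly p ` ?R)"
    by (intro compact_continuous_image continuous_at_imp_continuous_on ballI isCont_cpoly
        compact_cbox)
  then obtain B where "\<And>w. w \<in> cpoly p ` ?R \<Longrightarrow> cmod w \<le> B"
    using bounded_iff compact_imp_bounded by metis
  then show ?thesis
    by (intro that[of B]) (auto simp: in_cbox_complex_iff)
qed

definition real_rooted :: "real poly \<Rightarrow> bool" where
  "real_rooted p \<longleftrightarrow> (\<forall>z. cpoly p z = 0 \<longrightarrow> Im z = 0)"

lemma abs_poly_le_cmod_cpoly:
  assumes "real_rooted p"
  shows "\<bar>poly p x\<bar> \<le> cmod (cpoly p (Complex x y))"
proof -
  let ?P = "map_poly complex_of_real p"
  have factored: "cpoly p w = lead_coeff ?P * (\<Prod>r\<in>#proots ?P. w - r)" for w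
  proof -
    have "poly (\<Prod>r\<in>#M. [:- r, 1:]) w = (\<Prod>r\<in>#M. w - r)" for M
      by (induction M) (simp_all add: algebra_simps)
    then show ?thesis
      unfolding cpoly_def by (subst complex_poly_decompose_multiset[symmetric]) simp
  qed
  have "cmod (\<Prod>r\<in>#M. of_real x - r) \<le> cmod (\<Prod>r\<in>#M. Complex x y - r)"
    if "\<And>r. r \<in># M \<Longrightarrow> Im r = 0" for M
    using that
  proof (induction M)
    case (add r M)
    have "cmod (of_real x - r) = \<bar>Re (Complex x y - r)\<bar>"
      using add.prems by (simp add: cmod_eq_Re)
    also have "\<dots> \<le> cmod (Complex x y - r)"
      by (rule abs_Re_le_cmod)
    finally show ?case
      using add by (auto simp: norm_mult intro: mult_mono)
  qed simp
  moreover have "Im r = 0" if "r \<in># proots ?P" for r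
    using assms that by (cases "?P = 0") (auto simp: real_rooted_def cpoly_def)
  ultimately have "cmod (cpoly p (of_real x)) \<le> cmod (cpoly p (Complex x y))"
    unfolding factored norm_mult by (intro mult_left_mono) auto
  then show ?thesis
    by (simp add: cpoly_of_real)
qed

lemma poly_eq_prod_proots:
  fixes p :: "'a::idom poly"
  assumes "size (proots p) = degree p"
  shows "p = smult (lead_coeff p) (\<Prod>r\<in>#proots p. [:- r, 1:])"
  using assms
proof (induction p rule: poly_root_order_induct)
  case (no_roots p)
  then have "proots p = {#}"
    by (simp add: multiset_eqI order_root)
  with no_roots show ?case
    by (auto elim!: degree_eq_zeroE)
next
  case (root p x n)
  then have [simp]: "p \<noteq> 0" by auto
  have "proots ([:- x, 1:] ^ n * p) = replicate_mset n x + proots p"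
    by (simp add: proots_mult proots_power)
  moreover have "size (proots p) = degree p"
    using root.prems by (simp add: proots_mult proots_power degree_mult_eq degree_power_eq)
  ultimately show ?case
    using root.IH by (simp add: lead_coeff_mult lead_coeff_power flip: mult_smult_right)
qed simp

lemma bounded_poly_sublevel:
  fixes p :: "real poly"
  assumes "degree p > 0"
  shows "bounded {x. \<bar>poly p x\<bar> < M}"
proof -
  obtain c q where p: "p = pCons c q" and "q \<noteq> 0"
    using assms by (metis degree_pCons_0 less_numeral_extra(3) pCons_cases)
  then obtain R where "M \<le> norm (poly p x)" if "R \<le> norm x" for x
    using poly_infinity[of q M c] by blast
  then have "norm x \<le> R" if "x \<in> {x. \<bar>poly p x\<bar> < M}" for x
    using that by (metis linorder_not_le mem_Collect_eq nle_le real_norm_def)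
  then show ?thesis
    by (rule boundedI)
qed

section \<open>Integrability of inverse square roots\<close>

lemma set_integrable_inverse_sqrt_linear:
  "set_integrable lborel {c..d} (\<lambda>x. 1 / sqrt \<bar>x - r\<bar>)"
proof (cases "c \<le> d")
  case True
  define F where "F x = 2 * (sqrt (max 0 (x - r)) - sqrt (max 0 (r - x)))" for x
  have "(F has_vector_derivative 1 / sqrt \<bar>x - r\<bar>) (at x)" if "x \<noteq> r" for x
  proof (cases "x > r")
    case True
    have "((\<lambda>x. 2 * sqrt (x - r)) has_real_derivative 1 / sqrt \<bar>x - r\<bar>) (at x)"
      using True by (auto intro!: derivative_eq_intros simp: field_simps)
    then have "(F has_real_derivative 1 / sqrt \<bar>x - r\<bar>) (at x)"
      by (rule has_field_derivative_transform_within_open[where S = "{r<..}"])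
        (use True in \<open>auto simp: F_def max_def\<close>)
    then show ?thesis by (simp add: has_real_derivative_iff_has_vector_derivative)
  next
    case False
    have "((\<lambda>x. - 2 * sqrt (r - x)) has_real_derivative 1 / sqrt \<bar>x - r\<bar>) (at x)"
      using False that by (auto intro!: derivative_eq_intros simp: field_simps)
    then have "(F has_real_derivative 1 / sqrt \<bar>x - r\<bar>) (at x)"
      by (rule has_field_derivative_transform_within_open[where S = "{..<r}"])
        (use False that in \<open>auto simp: F_def max_def\<close>)
    then show ?thesis by (simp add: has_real_derivative_iff_has_vector_derivative)
  qed
  moreover have "continuous_on {c..d} F"
    unfolding F_def by (intro continuous_intros)
  ultimately have "((\<lambda>x. 1 / sqrt \<bar>x - r\<bar>) has_integral F d - F c) {c..d}"
    using True by (intro fundamental_theorem_of_calculus_interior_strong[where S = "{r}"]) auto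
  then have "set_integrable lebesgue {c..d} (\<lambda>x. 1 / sqrt \<bar>x - r\<bar>)"
    by (intro nonnegative_absolutely_integrable_1) auto
  then show ?thesis
    unfolding set_integrable_def by (subst (asm) integrable_completion) auto
qed simp

lemma inverse_sqrt_mult_bound:
  fixes f g :: "real \<Rightarrow> real"
  assumes cont: "continuous_on {c..d} f" "continuous_on {c..d} g"
    and no_common_zero: "\<And>x. x \<in> {c..d} \<Longrightarrow> f x \<noteq> 0 \<or> g x \<noteq> 0"
  obtains C where "\<And>x. x \<in> {c..d} \<Longrightarrow>
    1 / sqrt \<bar>f x * g x\<bar> \<le> C * (1 / sqrt \<bar>f x\<bar> + 1 / sqrt \<bar>g x\<bar>)"
proof (cases "c \<le> d")
  case True
  let ?h = "\<lambda>x. sqrt \<bar>f x\<bar> + sqrt \<bar>g x\<bar>"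
  have "continuous_on {c..d} ?h"
    by (intro continuous_intros cont)
  then obtain x0 where x0: "x0 \<in> {c..d}" "\<And>x. x \<in> {c..d} \<Longrightarrow> ?h x0 \<le> ?h x"
    using continuous_attains_inf[of "{c..d}" ?h] True by auto
  define \<delta> where "\<delta> = ?h x0"
  have "\<delta> > 0"
    using no_common_zero[OF x0(1)] unfolding \<delta>_def
    by (auto intro: add_pos_nonneg add_nonneg_pos)
  have "1 / sqrt \<bar>f x * g x\<bar> \<le> 1 / \<delta> * (1 / sqrt \<bar>f x\<bar> + 1 / sqrt \<bar>g x\<bar>)" if "x \<in> {c..d}" for x
  proof (cases "f x = 0 \<or> g x = 0")
    case False
    then have "1 / sqrt \<bar>f x * g x\<bar> = 1 / ?h x * (1 / sqrt \<bar>f x\<bar> + 1 / sqrt \<bar>g x\<bar>)"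
      by (simp add: abs_mult real_sqrt_mult divide_simps add_pos_pos less_imp_neq[symmetric])
    also have "\<dots> \<le> 1 / \<delta> * (1 / sqrt \<bar>f x\<bar> + 1 / sqrt \<bar>g x\<bar>)"
      using x0(2)[OF that] \<open>\<delta> > 0\<close> by (intro mult_right_mono divide_left_mono) (auto simp: \<delta>_def)
    finally show ?thesis .
  qed (use \<open>\<delta> > 0\<close> in auto)
  then show ?thesis by (rule that)
qed (use that in simp)

lemma set_integrable_inverse_sqrt_mult:
  fixes f g :: "real \<Rightarrow> real"
  assumes "continuous_on {c..d} f" "continuous_on {c..d} g"
    and "\<And>x. x \<in> {c..d} \<Longrightarrow> f x \<noteq> 0 \<or> g x \<noteq> 0"
    and f: "set_integrable lborel {c..d} (\<lambda>x. 1 / sqrt \<bar>f x\<bar>)"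
    and g: "set_integrable lborel {c..d} (\<lambda>x. 1 / sqrt \<bar>g x\<bar>)"
  shows "set_integrable lborel {c..d} (\<lambda>x. 1 / sqrt \<bar>f x * g x\<bar>)"
proof -
  obtain C where C: "1 / sqrt \<bar>f x * g x\<bar> \<le> C * (1 / sqrt \<bar>f x\<bar> + 1 / sqrt \<bar>g x\<bar>)"
    if "x \<in> {c..d}" for x
    using inverse_sqrt_mult_bound[OF assms(1-3)] by blast
  show ?thesis
  proof (rule set_integrable_bound)
    show "set_integrable lborel {c..d} (\<lambda>x. C * (1 / sqrt \<bar>f x\<bar> + 1 / sqrt \<bar>g x\<bar>))"
      using f g by (intro set_integrable_mult_right set_integral_add)
    have "(\<lambda>x. indicator {c..d} x *\<^sub>R (1 / sqrt \<bar>f x\<bar>) * (indicator {c..d} x *\<^sub>R (1 / sqrt \<bar>g x\<bar>)))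
        \<in> borel_measurable lborel"
      using f g unfolding set_integrable_def
      by (intro borel_measurable_times borel_measurable_integrable)
    then show "set_borel_measurable lborel {c..d} (\<lambda>x. 1 / sqrt \<bar>f x * g x\<bar>)"
      unfolding set_borel_measurable_def
      by (rule measurable_cong[THEN iffD1, rotated])
        (auto simp: indicator_def abs_mult real_sqrt_mult)
    show "AE x in lborel. x \<in> {c..d} \<longrightarrow>
        norm (1 / sqrt \<bar>f x * g x\<bar>) \<le> norm (C * (1 / sqrt \<bar>f x\<bar> + 1 / sqrt \<bar>g x\<bar>))"
    proof (intro AE_I2 impI)
      fix x assume "x \<in> {c..d}"
      have "norm (1 / sqrt \<bar>f x * g x\<bar>) = 1 / sqrt \<bar>f x * g x\<bar>" by simp
      also note C[OF \<open>x \<in> {c..d}\<close>]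
      also note abs_ge_self
      finally show "norm (1 / sqrt \<bar>f x * g x\<bar>) \<le> norm (C * (1 / sqrt \<bar>f x\<bar> + 1 / sqrt \<bar>g x\<bar>))"
        by simp
    qed
  qed
qed

lemma rsquarefree_linear_mult:
  fixes q :: "'a::field_char_0 poly"
  assumes "rsquarefree ([:- r, 1:] * q)"
  shows "rsquarefree q" "poly q r \<noteq> 0"
proof -
  have eval: "poly ([:- r, 1:] * q) x = (x - r) * poly q x" for x
    by (simp add: algebra_simps)
  have eval_deriv: "poly (pderiv ([:- r, 1:] * q)) x = poly q x + (x - r) * poly (pderiv q) x" for x
    unfolding pderiv_mult by (simp add: pderiv_pCons algebra_simps)
  have simple: "\<not> ((x - r) * poly q x = 0 \<and> poly q x + (x - r) * poly (pderiv q) x = 0)" for x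
    using assms unfolding rsquarefree_roots eval eval_deriv by blast
  show "rsquarefree q"
    unfolding rsquarefree_roots using simple by (metis add_0 mult_zero_right)
  show "poly q r \<noteq> 0"
    using simple[of r] by simp
qed

lemma set_integrable_inverse_sqrt_poly:
  fixes p :: "real poly"
  assumes "rsquarefree p"
  shows "set_integrable lborel {c..d} (\<lambda>x. 1 / sqrt \<bar>poly p x\<bar>)"
  using assms
proof (induction "degree p" arbitrary: p rule: less_induct)
  case less
  show ?case
  proof (cases "\<exists>r. poly p r = 0")
    case False
    then show ?thesis
      by (intro borel_integrable_atLeastAtMost' continuous_intros) auto
  next
    case True
    then obtain r q where p: "p = [:- r, 1:] * q"
      by (metis dvdE poly_eq_0_iff_dvd)
    have q: "rsquarefree q" "poly q r \<noteq> 0"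
      using rsquarefree_linear_mult less.prems unfolding p by blast+
    then have "degree p = Suc (degree q)"
      unfolding p by (subst degree_mult_eq) (auto simp: rsquarefree_def)
    then have "set_integrable lborel {c..d} (\<lambda>x. 1 / sqrt \<bar>poly q x\<bar>)"
      using less.hyps q(1) by simp
    then have "set_integrable lborel {c..d} (\<lambda>x. 1 / sqrt \<bar>(x - r) * poly q x\<bar>)"
      using q(2)
      by (intro set_integrable_inverse_sqrt_mult set_integrable_inverse_sqrt_linear
          continuous_intros) auto
    moreover have "poly p x = (x - r) * poly q x" for x
      unfolding p by (simp add: algebra_simps)
    ultimately show ?thesis by simp
  qed
qed

section \<open>The resolvent of a discrete Schroedinger operator\<close>

definition schroedinger_op :: "(int \<Rightarrow> real) \<Rightarrow> (int \<Rightarrow> complex) \<Rightarrow> (int \<Rightarrow> complex)" where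
  "schroedinger_op b u = (\<lambda>n. 1/2 * u (n - 1) + of_real (b n) * u n + 1/2 * u (n + 1))"

lemma schroedinger_op_solution:
  assumes "is_solution (\<lambda>n. of_real (b n)) z u"
  shows "z * u n - schroedinger_op b u n = 0"
  using solution_succ[OF assms, of n] by (simp add: schroedinger_op_def field_simps)

lemma ell2I_halves:
  assumes "summable (\<lambda>n. (cmod (u (int n)))\<^sup>2)" "summable (\<lambda>n. (cmod (u (- int n)))\<^sup>2)"
  shows "u \<in> ell2"
proof -
  let ?f = "\<lambda>n. (cmod (u n))\<^sup>2"
  have summable_range: "?f summable_on range h"
    if "inj h" "summable (\<lambda>n. ?f (h n))" for h :: "nat \<Rightarrow> int"
    using that by (simp add: summable_on_reindex o_def summable_nonneg_imp_summable_on)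
  have "summable (\<lambda>n. ?f (- int (Suc n)))"
    using assms(2) by (subst summable_Suc_iff)
  then have "?f summable_on (range int \<union> range (\<lambda>n. - int (Suc n)))"
    using assms(1) by (intro summable_on_Un_disjoint summable_range) (auto simp: inj_def)
  moreover have "range int \<union> range (\<lambda>n. - int (Suc n)) = UNIV"
    by (metis (no_types, lifting) UNIV_eq_I UnCI int_cases rangeI)
  ultimately show ?thesis by (simp add: ell2_def)
qed

lemma ell2_shift:
  assumes "u \<in> ell2"
  shows "(\<lambda>n. u (n + k)) \<in> ell2"
proof -
  have "bij (\<lambda>n :: int. n + k)"
    by (intro bijI injI surjI[where f = "\<lambda>n. n - k"]) auto
  from summable_on_reindex_bij_betw[OF this, of "\<lambda>n. (cmod (u n))\<^sup>2"] show ?thesis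
    using assms by (simp add: ell2_def)
qed

lemma ell2_diff:
  assumes "u \<in> ell2" "v \<in> ell2"
  shows "(\<lambda>n. u n - v n) \<in> ell2"
proof -
  have "(cmod (x - y))\<^sup>2 \<le> 2 * (cmod x)\<^sup>2 + 2 * (cmod y)\<^sup>2" for x y
  proof -
    have "(cmod (x - y))\<^sup>2 + (cmod (x + y))\<^sup>2 = 2 * (cmod x)\<^sup>2 + 2 * (cmod y)\<^sup>2"
      unfolding cmod_power2 by (simp add: power2_eq_square algebra_simps)
    then show ?thesis
      using zero_le_power2[of "cmod (x + y)"] by linarith
  qed
  moreover have "(\<lambda>n. 2 * (cmod (u n))\<^sup>2 + 2 * (cmod (v n))\<^sup>2) summable_on UNIV"
    using assms by (intro summable_on_add summable_on_cmult_right) (auto simp: ell2_def)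
  ultimately show ?thesis
    unfolding ell2_def by (auto intro: summable_on_comparison_test)
qed

lemma ell2_inner_ebasis: "ell2_inner (ebasis i) u = u i"
proof -
  have "ell2_inner (ebasis i) u = (\<Sum>\<^sub>\<infinity>n\<in>{i}. cnj (ebasis i n) * u n)"
    unfolding ell2_inner_def by (rule infsum_cong_neutral) (auto simp: ebasis_def)
  then show ?thesis by (simp add: ebasis_def)
qed

definition current :: "(int \<Rightarrow> complex) \<Rightarrow> int \<Rightarrow> real" where
  "current u n = Im (cnj (u n) * u (n + 1))"

lemma Im_cnj_schroedinger_op:
  "Im (cnj (u n) * schroedinger_op b u n) = (current u n - current u (n - 1)) / 2"
  by (simp add: current_def schroedinger_op_def field_simps)

lemma current_summable:
  assumes "u \<in> ell2"
  shows "current u summable_on UNIV"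
proof -
  have "\<bar>current u n\<bar> \<le> (cmod (u n))\<^sup>2 + (cmod (u (n + 1)))\<^sup>2" for n
  proof -
    have "\<bar>current u n\<bar> \<le> cmod (u n) * cmod (u (n + 1))"
      unfolding current_def using abs_Im_le_cmod by (metis complex_mod_cnj norm_mult)
    also have "\<dots> \<le> (cmod (u n))\<^sup>2 + (cmod (u (n + 1)))\<^sup>2"
      using sum_squares_bound[of "cmod (u n)" "cmod (u (n + 1))"]
        mult_nonneg_nonneg[OF norm_ge_zero norm_ge_zero, of "u n" "u (n + 1)"] by linarith
    finally show ?thesis .
  qed
  moreover have "(\<lambda>n. (cmod (u n))\<^sup>2 + (cmod (u (n + 1)))\<^sup>2) summable_on UNIV"
    using assms ell2_shift[OF assms, of 1] by (intro summable_on_add) (auto simp: ell2_def)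
  ultimately have "(\<lambda>n. norm (current u n)) summable_on UNIV"
    by (auto intro: summable_on_comparison_test)
  then show ?thesis
    by (rule abs_summable_summable)
qed

text \<open>The currents telescope, so \<open>\<langle>u, T u\<rangle>\<close> is real: this is the self-adjointness of
  \<open>T\<close> in the form in which it is needed.\<close>

lemma has_sum_Im_cnj_schroedinger_op:
  assumes "u \<in> ell2"
  shows "((\<lambda>n. Im (cnj (u n) * schroedinger_op b u n)) has_sum 0) UNIV"
proof -
  obtain S where S: "(current u has_sum S) UNIV"
    using current_summable[OF assms] by (auto simp: summable_on_def)
  have "bij (\<lambda>n :: int. n - 1)"
    by (intro bijI injI surjI[where f = "\<lambda>n. n + 1"]) auto
  then have "((\<lambda>n. current u (n - 1)) has_sum S) UNIV"
    using has_sum_reindex_bij_betw S by blast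
  from has_sum_add[OF has_sum_cmult_right[OF S, of "1/2"] has_sum_cmult_right[OF this, of "- 1/2"]]
  show ?thesis
    unfolding Im_cnj_schroedinger_op by (simp add: diff_divide_distrib)
qed

lemma resolvent_equation_norm:
  assumes u: "u \<in> ell2" and eq: "\<And>n. z * u n - schroedinger_op b u n = v n"
  shows "((\<lambda>n. Im (cnj (u n) * v n)) has_sum Im z * (\<Sum>\<^sub>\<infinity>n. (cmod (u n))\<^sup>2)) UNIV"
proof -
  have "((\<lambda>n. (cmod (u n))\<^sup>2) has_sum (\<Sum>\<^sub>\<infinity>n. (cmod (u n))\<^sup>2)) UNIV"
    using u by (simp add: ell2_def)
  note sums = has_sum_add[OF has_sum_cmult_right[OF this, of "Im z"]
      has_sum_cmult_right[OF has_sum_Im_cnj_schroedinger_op[OF u, of b], of "- 1"]]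
  have "Im (cnj (u n) * v n) =
      Im z * (cmod (u n))\<^sup>2 + - 1 * Im (cnj (u n) * schroedinger_op b u n)" for n
    unfolding cmod_power2 by (simp add: power2_eq_square algebra_simps flip: eq)
  with sums show ?thesis by simp
qed

lemma resolvent_equation_unique:
  assumes "Im z \<noteq> 0" "u \<in> ell2" "u' \<in> ell2"
    and "\<And>n. z * u n - schroedinger_op b u n = z * u' n - schroedinger_op b u' n"
  shows "u = u'"
proof -
  let ?d = "\<lambda>n. u n - u' n"
  have d: "?d \<in> ell2"
    using assms by (intro ell2_diff)
  moreover have "z * ?d n - schroedinger_op b ?d n = 0" for n
    using assms(4)[of n] by (simp add: schroedinger_op_def algebra_simps)
  ultimately have "((\<lambda>n :: int. 0 :: real) has_sum Im z * (\<Sum>\<^sub>\<infinity>n. (cmod (?d n))\<^sup>2)) UNIV"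
    using resolvent_equation_norm[of ?d z b "\<lambda>n. 0"] by simp
  then have "(\<Sum>\<^sub>\<infinity>n. (cmod (?d n))\<^sup>2) = 0"
    using has_sum_unique[OF has_sum_0_simp] assms(1) by (metis mult_eq_0_iff)
  then have "(cmod (?d n))\<^sup>2 = 0" for n
    using d nonneg_infsum_le_0D[of "\<lambda>n. (cmod (?d n))\<^sup>2" UNIV n] by (simp add: ell2_def)
  then show ?thesis by (simp add: fun_eq_iff)
qed

lemma resolvent_eqI:
  assumes "Im z \<noteq> 0" and u: "u \<in> ell2"
    and eq: "\<And>n. z * u n - schroedinger_op b u n = v n"
  shows "resolvent (schroedinger_op b) z v = u"
  unfolding resolvent_def
proof (rule the_inv_into_f_eq)
  show "inj_on (\<lambda>u n. z * u n - schroedinger_op b u n) ell2"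
    by (rule inj_onI) (metis assms(1) resolvent_equation_unique)
qed (use u eq in auto)

definition green :: "(int \<Rightarrow> real) \<Rightarrow> int \<Rightarrow> int \<Rightarrow> complex \<Rightarrow> complex" where
  "green b i j z = ell2_inner (ebasis i) (resolvent (schroedinger_op b) z (ebasis j))"

lemma green_eqI:
  assumes "Im z \<noteq> 0" "u \<in> ell2" "\<And>n. z * u n - schroedinger_op b u n = ebasis j n"
  shows "green b i j z = u i"
  unfolding green_def by (simp add: ell2_inner_ebasis resolvent_eqI[OF assms])

lemma resolvent_equation_Im_nonpos:
  assumes "Im z > 0" "u \<in> ell2" "\<And>n. z * u n - schroedinger_op b u n = ebasis j n"
  shows "Im (u j) \<le> 0"
proof -
  have "((\<lambda>n. Im (cnj (u n) * ebasis j n)) has_sum Im z * (\<Sum>\<^sub>\<infinity>n. (cmod (u n))\<^sup>2)) UNIV"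
    by (rule resolvent_equation_norm[OF assms(2,3)])
  also have "?this \<longleftrightarrow> ((\<lambda>n. - Im (u n)) has_sum Im z * (\<Sum>\<^sub>\<infinity>n. (cmod (u n))\<^sup>2)) {j}"
    by (rule has_sum_cong_neutral) (auto simp: ebasis_def)
  finally have "- Im (u j) = Im z * (\<Sum>\<^sub>\<infinity>n. (cmod (u n))\<^sup>2)"
    by (simp add: has_sum_finite_iff)
  also have "\<dots> \<ge> 0"
    using assms(1) by (intro mult_nonneg_nonneg infsum_nonneg) auto
  finally show ?thesis by simp
qed

lemma ell2_glued_solutions:
  assumes "summable (\<lambda>n. (cmod (\<phi> (int n)))\<^sup>2)" "summable (\<lambda>n. (cmod (\<psi> (- int n)))\<^sup>2)"
  shows "(\<lambda>n. c * \<phi> (max n j) * \<psi> (min n j)) \<in> ell2"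
proof (rule ell2I_halves)
  let ?u = "\<lambda>n. c * \<phi> (max n j) * \<psi> (min n j)"
  have "\<forall>\<^sub>F n in sequentially.
      (cmod (?u (int n)))\<^sup>2 = (cmod (c * \<psi> j))\<^sup>2 * (cmod (\<phi> (int n)))\<^sup>2"
    using eventually_gt_at_top[of "nat j"]
    by eventually_elim (simp add: max_def min_def norm_mult power_mult_distrib)
  then show "summable (\<lambda>n. (cmod (?u (int n)))\<^sup>2)"
    by (rule summable_cong[THEN iffD2]) (rule summable_mult[OF assms(1)])
  have "\<forall>\<^sub>F n in sequentially.
      (cmod (?u (- int n)))\<^sup>2 = (cmod (c * \<phi> j))\<^sup>2 * (cmod (\<psi> (- int n)))\<^sup>2"
    using eventually_gt_at_top[of "nat (- j)"]
    by eventually_elim (simp add: max_def min_def norm_mult power_mult_distrib)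
  then show "summable (\<lambda>n. (cmod (?u (- int n)))\<^sup>2)"
    by (rule summable_cong[THEN iffD2]) (rule summable_mult[OF assms(2)])
qed

lemma glued_solutions_resolvent_equation:
  fixes b :: "int \<Rightarrow> real" and z :: complex
  assumes \<phi>: "is_solution (\<lambda>n. of_real (b n)) z \<phi>" and \<psi>: "is_solution (\<lambda>n. of_real (b n)) z \<psi>"
    and W: "wronskian \<phi> \<psi> 0 \<noteq> 0"
  defines "u \<equiv> \<lambda>j n. 2 / wronskian \<phi> \<psi> 0 * \<phi> (max n j) * \<psi> (min n j)"
  shows "z * u j n - schroedinger_op b (u j) n = ebasis j n"
proof -
  let ?W = "wronskian \<phi> \<psi> 0"
  consider "n > j" | "n < j" | "n = j" by linarith
  then show ?thesis
  proof cases
    case 1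
    then have "z * u j n - schroedinger_op b (u j) n =
        2 / ?W * \<psi> j * (z * \<phi> n - schroedinger_op b \<phi> n)"
      by (simp add: schroedinger_op_def u_def algebra_simps)
    with 1 show ?thesis by (simp add: schroedinger_op_solution[OF \<phi>] ebasis_def)
  next
    case 2
    then have "z * u j n - schroedinger_op b (u j) n =
        2 / ?W * \<phi> j * (z * \<psi> n - schroedinger_op b \<psi> n)"
      by (simp add: schroedinger_op_def u_def algebra_simps)
    with 2 show ?thesis by (simp add: schroedinger_op_solution[OF \<psi>] ebasis_def)
  next
    case 3
    have "z * u j j - schroedinger_op b (u j) j =
        2 / ?W * \<phi> j * (z * \<psi> j - schroedinger_op b \<psi> j) + (\<phi> j * \<psi> (j + 1) - \<phi> (j + 1) * \<psi> j) / ?W"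
      by (simp add: schroedinger_op_def u_def algebra_simps diff_divide_distrib)
    also have "\<dots> = wronskian \<phi> \<psi> j / ?W"
      by (simp add: schroedinger_op_solution[OF \<psi>] wronskian_def)
    also have "\<dots> = 1"
      using W wronskian_eq_wronskian_0[OF \<phi> \<psi>] by simp
    finally show ?thesis using 3 by (simp add: ebasis_def)
  qed
qed

lemma
  fixes b :: "int \<Rightarrow> real" and z :: complex
  assumes z: "Im z \<noteq> 0"
    and \<phi>: "is_solution (\<lambda>n. of_real (b n)) z \<phi>" "summable (\<lambda>n. (cmod (\<phi> (int n)))\<^sup>2)"
    and \<psi>: "is_solution (\<lambda>n. of_real (b n)) z \<psi>" "summable (\<lambda>n. (cmod (\<psi> (- int n)))\<^sup>2)"
    and W: "wronskian \<phi> \<psi> 0 \<noteq> 0"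
  shows green_eq_glued_solutions:
      "green b i j z = 2 / wronskian \<phi> \<psi> 0 * \<phi> (max i j) * \<psi> (min i j)"
    and green_diag_Im_nonpos_if_glued: "Im z > 0 \<Longrightarrow> Im (green b j j z) \<le> 0"
proof -
  let ?u = "\<lambda>n. 2 / wronskian \<phi> \<psi> 0 * \<phi> (max n j) * \<psi> (min n j)"
  have u: "?u \<in> ell2"
    by (rule ell2_glued_solutions[OF \<phi>(2) \<psi>(2)])
  have eq: "z * ?u n - schroedinger_op b ?u n = ebasis j n" for n
    by (rule glued_solutions_resolvent_equation[OF \<phi>(1) \<psi>(1) W])
  show green: "green b i j z = ?u i" for i
    by (rule green_eqI[OF z u eq])
  show "Im (green b j j z) \<le> 0" if "Im z > 0"
    unfolding green by (rule resolvent_equation_Im_nonpos[OF that u eq])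
qed

section \<open>Floquet and Weyl solutions\<close>

lemma floquet_solution_unimodular:
  fixes b :: "int \<Rightarrow> real"
  assumes N: "N > 0" and z: "Im z \<noteq> 0" and u: "is_solution (\<lambda>n. of_real (b n)) z u"
    and floquet: "\<And>n. u (n + int N) = w * u n" and w: "cmod w = 1"
  shows "u n = 0"
proof -
  have step: "current u k - current u (k - 1) = 2 * Im z * (cmod (u k))\<^sup>2" for k
  proof -
    have "schroedinger_op b u k = z * u k"
      using schroedinger_op_solution[OF u, of k] by simp
    then show ?thesis
      using Im_cnj_schroedinger_op[of u k b]
      unfolding cmod_power2 by (simp add: power2_eq_square algebra_simps)
  qed
  have "current u (n - 1 + int N) = (cmod w)\<^sup>2 * current u (n - 1)"
    using floquet[of "n - 1"] floquet[of n]
    unfolding current_def cmod_power2 by (simp add: power2_eq_square algebra_simps)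
  then have "current u (n - 1 + int N) = current u (n - 1)"
    by (simp add: w)
  moreover have "current u (n - 1 + int M) - current u (n - 1) =
      2 * Im z * (\<Sum>k<M. (cmod (u (n + int k)))\<^sup>2)" for M
  proof (induction M)
    case (Suc M)
    have "n - 1 + int (Suc M) = n + int M" "n - 1 + int M = n + int M - 1" by simp_all
    with Suc step[of "n + int M"] show ?case by (simp add: algebra_simps)
  qed simp
  ultimately have "(\<Sum>k<N. (cmod (u (n + int k)))\<^sup>2) = 0"
    using z by (metis diff_self mult_eq_0_iff zero_neq_numeral)
  then have "\<forall>k\<in>{..<N}. (cmod (u (n + int k)))\<^sup>2 = 0"
    by (subst (asm) sum_nonneg_eq_0_iff) auto
  from this[rule_format, of 0] show ?thesis
    using N by simp
qed

lemma summable_geometric_blocks: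
  fixes f :: "nat \<Rightarrow> real"
  assumes f: "\<And>n. f n \<ge> 0" and c: "c < 1" and shift: "\<And>n. f (n + N) = c * f n"
  shows "summable f"
proof (rule summableI_nonneg_bounded[OF f])
  fix n
  let ?T = "\<lambda>n. \<Sum>i<n. f i"
  have "?T n \<le> ?T (n + N)"
    using f by (intro sum_mono2) auto
  also have "?T (n + N) = ?T N + (\<Sum>i<n. f (i + N))"
    by (induction n) (simp_all add: add.commute)
  also have "\<dots> = ?T N + c * ?T n"
    by (simp add: shift sum_distrib_left)
  finally have "(1 - c) * ?T n \<le> ?T N" by (simp add: algebra_simps)
  then show "?T n \<le> ?T N / (1 - c)" using c by (simp add: field_simps)
qed

lemma palindromic_quadratic_root:
  fixes g :: complex
  obtains w where "w\<^sup>2 - 2 * g * w + 1 = 0" "cmod w \<le> 1"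
proof -
  define w where "w = g + csqrt (g\<^sup>2 - 1)"
  define w' where "w' = g - csqrt (g\<^sup>2 - 1)"
  have "w * w' = g\<^sup>2 - (csqrt (g\<^sup>2 - 1))\<^sup>2"
    by (simp add: w_def w'_def algebra_simps power2_eq_square)
  then have "cmod w * cmod w' = 1"
    by (simp flip: norm_mult)
  then have "cmod w \<le> 1 \<or> cmod w' \<le> 1"
    by (metis less_1_mult linorder_not_le order_less_irrefl)
  moreover have "w\<^sup>2 - 2 * g * w + 1 = (w - g)\<^sup>2 - (g\<^sup>2 - 1)"
    "w'\<^sup>2 - 2 * g * w' + 1 = (w' - g)\<^sup>2 - (g\<^sup>2 - 1)"
    by (simp_all add: power2_eq_square algebra_simps)
  then have "w\<^sup>2 - 2 * g * w + 1 = 0" "w'\<^sup>2 - 2 * g * w' + 1 = 0"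
    by (simp_all add: w_def w'_def)
  ultimately show ?thesis using that by blast
qed

locale even_periodic_potential = even_periodic b N for b :: "int \<Rightarrow> real" and N
begin

sublocale complex: even_periodic "\<lambda>n. complex_of_real (b n)" N
  by unfold_locales (simp_all add: period_pos even periodic)

abbreviation bc :: "int \<Rightarrow> complex" where
  "bc \<equiv> \<lambda>n. complex_of_real (b n)"

lemma
  assumes z: "Im z \<noteq> 0"
  shows even_shift_coeff_nonzero: "even_shift_coeff bc N z \<noteq> 0"
    and odd_sol_period_nonzero: "odd_sol bc z (int N) \<noteq> 0"
proof -
  let ?g = "even_sol bc z (int N)" and ?s = "odd_sol bc z (int N)"
    and ?D = "even_shift_coeff bc N z"
  have False if "?D = 0 \<or> ?s = 0"
  proof -
    have "?g\<^sup>2 = 1"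
      using complex.even_sol_square_minus_1[of z] that by auto
    then have "cmod ?g = 1"
      by (auto simp: power2_eq_1_iff)
    note vanishing = floquet_solution_unimodular[OF period_pos z _ _ this]
    from that show False
    proof
      assume "?D = 0"
      then have "even_sol bc z (n + int N) = ?g * even_sol bc z n" for n
        using complex.even_sol_shift[of z n] by simp
      from vanishing[OF is_solution_even_sol this, of 0] show False by simp
    next
      assume "?s = 0"
      then have "odd_sol bc z (n + int N) = ?g * odd_sol bc z n" for n
        using complex.odd_sol_shift[of z n] by simp
      from vanishing[OF is_solution_odd_sol this, of 1] show False by simp
    qed
  qed
  then show "?D \<noteq> 0" "?s \<noteq> 0" by blast+
qed

lemma weyl_solution:
  assumes z: "Im z \<noteq> 0"
  obtains m where "m\<^sup>2 = even_shift_coeff bc N z / odd_sol bc z (int N)"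
    "summable (\<lambda>n. (cmod (even_sol bc z (int n) + m * odd_sol bc z (int n)))\<^sup>2)"
proof -
  let ?g = "even_sol bc z (int N)" and ?s = "odd_sol bc z (int N)"
    and ?D = "even_shift_coeff bc N z"
  have s: "?s \<noteq> 0"
    by (rule odd_sol_period_nonzero[OF z])
  obtain w where w: "w\<^sup>2 - 2 * ?g * w + 1 = 0" "cmod w \<le> 1"
    using palindromic_quadratic_root by blast
  define m where "m = (w - ?g) / ?s"
  define \<phi> where "\<phi> n = 1 * even_sol bc z n + m * odd_sol bc z n" for n
  have "(w - ?g)\<^sup>2 = (w\<^sup>2 - 2 * ?g * w + 1) + (?g\<^sup>2 - 1)"
    by (simp add: power2_eq_square algebra_simps)
  then have "(w - ?g)\<^sup>2 = ?D * ?s"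
    by (simp add: w(1) complex.even_sol_square_minus_1)
  then have m_square: "m\<^sup>2 = ?D / ?s"
    using s by (simp add: m_def power_divide power2_eq_square)
  have floquet: "\<phi> (n + int N) = w * \<phi> n" for n
  proof -
    have "w = ?g + m * ?s" "?D = m * m * ?s"
      using s m_square by (simp_all add: m_def power2_eq_square)
    then show ?thesis
      unfolding \<phi>_def complex.even_sol_shift complex.odd_sol_shift by (simp add: algebra_simps)
  qed
  have "is_solution bc z \<phi>"
    unfolding \<phi>_def [abs_def]
    by (rule is_solution_linear_combination[OF is_solution_even_sol is_solution_odd_sol])
  then have "cmod w \<noteq> 1"
    using floquet_solution_unimodular[of N z b \<phi> w 0] period_pos z floquet by (auto simp: \<phi>_def)
  with w(2) have "(cmod w)\<^sup>2 < 1"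
    by (simp add: power_less_one_iff abs_square_less_1)
  then have "summable (\<lambda>n. (cmod (\<phi> (int n)))\<^sup>2)"
    by (rule summable_geometric_blocks[where N = N, rotated])
      (simp_all add: floquet norm_mult power_mult_distrib)
  then show ?thesis
    using that[OF m_square] by (simp add: \<phi>_def)
qed

lemma green_weyl:
  assumes z: "Im z \<noteq> 0"
  obtains m where "m \<noteq> 0" "m\<^sup>2 = even_shift_coeff bc N z / odd_sol bc z (int N)"
    "green b 0 0 z = - 1 / m" "green b 0 1 z = - (z - b 0 + m) / m"
    "green b 1 1 z = - ((z - b 0)\<^sup>2 - m\<^sup>2) / m"
    "\<And>j. Im z > 0 \<Longrightarrow> Im (green b j j z) \<le> 0"
proof -
  obtain m where m: "m\<^sup>2 = even_shift_coeff bc N z / odd_sol bc z (int N)"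
    and decay: "summable (\<lambda>n. (cmod (even_sol bc z (int n) + m * odd_sol bc z (int n)))\<^sup>2)"
    using weyl_solution[OF z] by blast
  have "m \<noteq> 0"
    using m odd_sol_period_nonzero[OF z] even_shift_coeff_nonzero[OF z] by auto
  define \<phi> where "\<phi> n = 1 * even_sol bc z n + m * odd_sol bc z n" for n
  have \<phi>: "is_solution bc z \<phi>"
    unfolding \<phi>_def [abs_def]
    by (rule is_solution_linear_combination[OF is_solution_even_sol is_solution_odd_sol])
  define \<psi> where "\<psi> n = \<phi> (- n)" for n
  have \<psi>: "is_solution bc z \<psi>"
    unfolding \<psi>_def [abs_def] by (rule is_solution_reflect[where b = bc, OF complex.even \<phi>])
  have \<psi>_eq: "\<psi> n = even_sol bc z n - m * odd_sol bc z n" for n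
    by (simp add: \<psi>_def \<phi>_def)
  have W: "wronskian \<phi> \<psi> 0 = - 2 * m"
    by (simp add: wronskian_def \<psi>_eq) (simp add: \<phi>_def)
  have "wronskian \<phi> \<psi> 0 \<noteq> 0"
    using \<open>m \<noteq> 0\<close> by (simp add: W)
  moreover have "summable (\<lambda>n. (cmod (\<phi> (int n)))\<^sup>2)" "summable (\<lambda>n. (cmod (\<psi> (- int n)))\<^sup>2)"
    using decay by (simp_all add: \<psi>_def \<phi>_def)
  ultimately have green: "green b i j z = 2 / wronskian \<phi> \<psi> 0 * \<phi> (max i j) * \<psi> (min i j)"
    and nonpos: "Im z > 0 \<Longrightarrow> Im (green b j j z) \<le> 0" for i j
    using green_eq_glued_solutions[OF z \<phi> _ \<psi>] green_diag_Im_nonpos_if_glued[OF z \<phi> _ \<psi>] by blast+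
  have "green b 0 0 z = - 1 / m" "green b 0 1 z = - (z - b 0 + m) / m"
    "green b 1 1 z = - ((z - b 0)\<^sup>2 - m\<^sup>2) / m"
    using \<open>m \<noteq> 0\<close>
    by (simp_all add: green W \<psi>_eq) (simp_all add: \<phi>_def field_simps power2_eq_square)
  with \<open>m \<noteq> 0\<close> m nonpos show ?thesis
    using that by blast
qed

lemma green_diag_Im_nonpos: "Im z > 0 \<Longrightarrow> Im (green b j j z) \<le> 0"
  using green_weyl[of z] by (metis less_irrefl)

lemma green_00_square:
  assumes "Im z \<noteq> 0"
  shows "(green b 0 0 z)\<^sup>2 = odd_sol bc z (int N) / even_shift_coeff bc N z"
proof -
  obtain m where "m\<^sup>2 = even_shift_coeff bc N z / odd_sol bc z (int N)" "green b 0 0 z = - 1 / m"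
    using green_weyl[OF assms] by metis
  then show ?thesis by (simp add: power_divide)
qed

lemma green_01:
  assumes "Im z \<noteq> 0"
  shows "green b 0 1 z = (z - b 0) * green b 0 0 z - 1"
proof -
  obtain m where "m \<noteq> 0" and green: "green b 0 0 z = - 1 / m" "green b 0 1 z = - (z - b 0 + m) / m"
    using green_weyl[OF assms] by metis
  then show ?thesis
    unfolding green by (simp add: field_simps)
qed

lemma green_11:
  assumes "Im z \<noteq> 0"
  shows "green b 1 1 z = (z - b 0)\<^sup>2 * green b 0 0 z - 1 / green b 0 0 z"
proof -
  obtain m where "m \<noteq> 0" and green: "green b 0 0 z = - 1 / m"
    "green b 1 1 z = - ((z - b 0)\<^sup>2 - m\<^sup>2) / m"
    using green_weyl[OF assms] by metis
  then show ?thesis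
    unfolding green by (simp add: field_simps power2_eq_square)
qed

lemma green_11_square:
  assumes z: "Im z \<noteq> 0"
  shows "(green b 1 1 z)\<^sup>2 =
    (even_sol bc z (int N - 1) + (z - b 0) * odd_sol bc z (int N - 1))\<^sup>2 /
    ((even_sol bc z (int N))\<^sup>2 - 1)"
proof -
  let ?s = "odd_sol bc z (int N)" and ?D = "even_shift_coeff bc N z" and ?G = "green b 0 0 z"
  have nonzero: "?s \<noteq> 0" "?D \<noteq> 0"
    using odd_sol_period_nonzero[OF z] even_shift_coeff_nonzero[OF z] by auto
  have G: "?G\<^sup>2 = ?s / ?D"
    by (rule green_00_square[OF z])
  with nonzero have "?G \<noteq> 0" by auto
  then have "(green b 1 1 z)\<^sup>2 = ((z - b 0)\<^sup>2 * ?G\<^sup>2 - 1)\<^sup>2 / ?G\<^sup>2"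
    by (simp add: green_11[OF z] field_simps power2_eq_square)
  also have "\<dots> = ((z - b 0)\<^sup>2 * ?s - ?D)\<^sup>2 / (?D * ?s)"
    using nonzero unfolding G by (simp add: field_simps power2_eq_square)
  also have "(z - b 0)\<^sup>2 * ?s - ?D =
      even_sol bc z (int N - 1) + (z - b 0) * odd_sol bc z (int N - 1)"
    unfolding complex.even_sol_pred_period complex.odd_sol_pred_period
    by (simp add: algebra_simps power2_eq_square)
  finally show ?thesis
    by (simp add: complex.even_sol_square_minus_1)
qed

end

section \<open>Finite real measures\<close>

lemma finite_real_measure_sums:
  assumes "finite_real_measure \<nu>" "\<And>n. F n \<in> sets borel" "disjoint_family F"
  shows "(\<lambda>n. \<nu> (F n)) sums \<nu> (\<Union>n. F n)"
  using assms by (auto simp: finite_real_measure_def)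

lemma finite_real_measure_empty:
  assumes "finite_real_measure \<nu>"
  shows "\<nu> {} = 0"
  using finite_real_measure_sums[OF assms, of "\<lambda>_. {}"]
  by (auto simp: disjoint_family_on_def summable_const_iff dest: sums_summable)

lemma finite_real_measure_Un:
  assumes \<nu>: "finite_real_measure \<nu>" and "A \<in> sets borel" "B \<in> sets borel" "A \<inter> B = {}"
  shows "\<nu> (A \<union> B) = \<nu> A + \<nu> B"
proof -
  have "(\<lambda>n. \<nu> (binaryset A B n)) sums \<nu> (A \<union> B)"
    unfolding UN_binaryset_eq[symmetric]
    by (rule finite_real_measure_sums[OF \<nu>])
      (use assms in \<open>auto simp: binaryset_def disjoint_family_on_def\<close>)
  moreover have "(\<lambda>n. \<nu> (binaryset A B n)) sums (\<nu> A + \<nu> B)"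
    by (rule binaryset_sums[where f = \<nu>, OF finite_real_measure_empty[OF \<nu>]])
  ultimately show ?thesis
    by (rule sums_unique2)
qed

lemma finite_real_measure_Compl:
  assumes "finite_real_measure \<nu>" "A \<in> sets borel"
  shows "\<nu> (- A) = \<nu> UNIV - \<nu> A"
  using finite_real_measure_Un[OF assms(1), of A "- A"] assms(2) by (simp add: Compl_eq_Diff_UNIV)

lemma finite_real_measure_diff:
  assumes "finite_real_measure \<nu>" "finite_real_measure \<nu>'"
  shows "finite_real_measure (\<lambda>E. \<nu> E - \<nu>' E)"
  using assms unfolding finite_real_measure_def by (auto intro: sums_diff)

lemma finite_real_measure_incseq:
  assumes \<nu>: "finite_real_measure \<nu>" and A: "range A \<subseteq> sets borel" "incseq A"
  shows "(\<lambda>n. \<nu> (A n)) \<longlonglongrightarrow> \<nu> (\<Union>n. A n)"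
proof -
  have disjointed_borel: "disjointed A n \<in> sets borel" for n
    using sets.range_disjointed_sets[OF A(1)] by auto
  have "(\<Sum>i\<le>n. \<nu> (disjointed A i)) = \<nu> (A n)" for n
  proof (induction n)
    case (Suc n)
    have "disjointed A (Suc n) = A (Suc n) - A n"
      by (rule disjointed_mono[OF A(2)])
    moreover from this have "A (Suc n) = A n \<union> disjointed A (Suc n)"
      using A(2) by (auto simp: incseq_Suc_iff)
    ultimately have "\<nu> (A (Suc n)) = \<nu> (A n) + \<nu> (disjointed A (Suc n))"
      using finite_real_measure_Un[OF \<nu> _ disjointed_borel, of "A n" "Suc n"] A(1) by auto
    with Suc show ?case by simp
  qed simp
  moreover have "(\<lambda>n. \<nu> (disjointed A n)) sums \<nu> (\<Union>n. A n)"
    using finite_real_measure_sums[OF \<nu> disjointed_borel disjoint_family_disjointed]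
    by (simp add: UN_disjointed_eq)
  ultimately show ?thesis
    by (simp add: sums_def_le)
qed

lemma finite_real_measure_decseq:
  assumes \<nu>: "finite_real_measure \<nu>" and A: "range A \<subseteq> sets borel" "decseq A"
  shows "(\<lambda>n. \<nu> (A n)) \<longlonglongrightarrow> \<nu> (\<Inter>n. A n)"
proof -
  have borel: "A n \<in> sets borel" for n
    using A(1) by auto
  then have "(\<Inter>n. A n) \<in> sets borel"
    by auto
  note Compl = finite_real_measure_Compl[OF \<nu> borel] finite_real_measure_Compl[OF \<nu> this]
  have "(\<lambda>n. \<nu> (- A n)) \<longlonglongrightarrow> \<nu> (\<Union>n. - A n)"
    using borel A(2) by (intro finite_real_measure_incseq[OF \<nu>]) (auto simp: incseq_def decseq_def)
  also have "(\<Union>n. - A n) = - (\<Inter>n. A n)" by auto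
  finally have "(\<lambda>n. \<nu> UNIV - \<nu> (A n)) \<longlonglongrightarrow> \<nu> UNIV - \<nu> (\<Inter>n. A n)"
    unfolding Compl .
  from tendsto_diff[OF tendsto_const[of "\<nu> UNIV"] this] show ?thesis
    by (simp only: diff_diff_eq2 add_diff_cancel_left')
qed

lemma finite_real_measure_set_integral:
  assumes "integrable lborel \<rho>"
  shows "finite_real_measure (\<lambda>E. LINT x:E|lborel. \<rho> x)"
  unfolding finite_real_measure_def
proof (intro allI impI)
  fix F :: "nat \<Rightarrow> real set"
  assume F: "range F \<subseteq> sets borel" "disjoint_family F"
  have int: "set_integrable lborel E \<rho>" if "E \<in> sets borel" for E
    unfolding set_integrable_def using that assms by (intro integrable_mult_indicator) auto
  have "(LINT x:(\<Union>i<n. F i)|lborel. \<rho> x) = (\<Sum>i<n. LINT x:F i|lborel. \<rho> x)" for n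
    using F by (intro set_integral_finite_Union int) (auto simp: disjoint_family_on_def)
  moreover have "(\<lambda>n. LINT x:(\<Union>i<n. F i)|lborel. \<rho> x) \<longlonglongrightarrow> (LINT x:(\<Union>n. \<Union>i<n. F i)|lborel. \<rho> x)"
    using F by (intro set_integral_cont_up int) (auto simp: incseq_def dest: order.strict_trans2)
  moreover have "(\<Union>n. \<Union>i<n. F i) = (\<Union>n. F n)" by auto
  ultimately show "(\<lambda>n. LINT x:F n|lborel. \<rho> x) sums (LINT x:(\<Union>n. F n)|lborel. \<rho> x)"
    by (simp add: sums_def)
qed

lemma finite_real_measure_eq_0_atMost:
  assumes \<nu>: "finite_real_measure \<nu>" and atMost: "\<And>b. \<nu> {..b} = 0" and "E \<in> sets borel"
  shows "\<nu> E = 0"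
proof -
  have borel: "sigma_sets UNIV (range atMost) = (sets borel :: real set set)"
    by (subst borel_eq_atMost) simp
  have "(\<lambda>n. \<nu> {..real n}) \<longlonglongrightarrow> \<nu> (\<Union>n. {..real n})"
    by (intro finite_real_measure_incseq[OF \<nu>]) (auto simp: incseq_def)
  moreover have "(\<Union>n. {..real n}) = UNIV"
    using real_arch_simple by auto
  ultimately have UNIV: "\<nu> UNIV = 0"
    by (simp add: atMost LIMSEQ_const_iff)
  have "Int_stable (range atMost :: real set set)" "range atMost \<subseteq> Pow (UNIV :: real set)"
    "E \<in> sigma_sets UNIV (range atMost)"
    using assms borel by (auto simp: Int_stable_def)
  then show ?thesis
  proof (induction rule: sigma_sets_induct_disjoint)
    case (compl A)
    then show ?case
      using finite_real_measure_Compl[OF \<nu>, of A] borel UNIV by (simp add: Compl_eq_Diff_UNIV)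
  next
    case (union A)
    then have "(\<lambda>n. \<nu> (A n)) sums \<nu> (\<Union>n. A n)"
      using borel by (intro finite_real_measure_sums[OF \<nu>]) auto
    then show ?case
      using union by (metis (no_types, lifting) sums_0 sums_unique2)
  qed (auto simp: atMost finite_real_measure_empty[OF \<nu>])
qed

lemma finite_real_measure_eq_0_intervals:
  assumes \<nu>: "finite_real_measure \<nu>"
    and intervals: "\<And>c d. c < d \<Longrightarrow> \<nu> {c..d} + \<nu> {c<..<d} = 0" and "E \<in> sets borel"
  shows "\<nu> E = 0"
proof (rule finite_real_measure_eq_0_atMost[OF \<nu> _ \<open>E \<in> sets borel\<close>])
  have half_lines: "\<nu> {..d} + \<nu> {..<d} = 0" for d
  proof -
    let ?c = "\<lambda>n. d - 1 - real n"
    have "(\<lambda>n. \<nu> {?c n..d} + \<nu> {?c n<..<d}) \<longlonglongrightarrow> \<nu> (\<Union>n. {?c n..d}) + \<nu> (\<Union>n. {?c n<..<d})"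
      by (intro tendsto_add finite_real_measure_incseq[OF \<nu>]) (auto simp: incseq_def)
    moreover have "\<exists>n. ?c n < x" for x
      using reals_Archimedean2[of "d - 1 - x"] by (auto simp: algebra_simps)
    then have "(\<Union>n. {?c n..d}) = {..d}" "(\<Union>n. {?c n<..<d}) = {..<d}"
      by (fastforce intro: less_imp_le)+
    ultimately show ?thesis
      by (simp add: intervals LIMSEQ_const_iff)
  qed
  fix b
  let ?d = "\<lambda>n. b + inverse (real (Suc n))"
  have "(\<lambda>n. \<nu> {..?d n} + \<nu> {..<?d n}) \<longlonglongrightarrow> \<nu> (\<Inter>n. {..?d n}) + \<nu> (\<Inter>n. {..<?d n})"
    by (intro tendsto_add finite_real_measure_decseq[OF \<nu>])
      (auto simp: decseq_def le_imp_inverse_le intro: order_trans)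
  moreover have "(\<Inter>n. {..?d n}) = {..b}" "(\<Inter>n. {..<?d n}) = {..b}"
  proof -
    have limit: "x \<le> b" if "\<And>n. x \<le> ?d n" for x
      using LIMSEQ_le_const[OF LIMSEQ_inverse_real_of_nat_add[of b]] that by blast
    have "b < ?d n" for n by simp
    then have "(\<forall>n. x \<le> ?d n) \<longleftrightarrow> x \<le> b" "(\<forall>n. x < ?d n) \<longleftrightarrow> x \<le> b" for x
      using limit[of x] by (meson le_less_trans less_imp_le)+
    then show "(\<Inter>n. {..?d n}) = {..b}" "(\<Inter>n. {..<?d n}) = {..b}"
      by (simp_all only: set_eq_iff INT_iff atMost_iff lessThan_iff ball_UNIV simp_thms)
  qed
  ultimately show "\<nu> {..b} = 0"
    by (simp add: half_lines LIMSEQ_const_iff)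
qed

section \<open>Jordan decompositions\<close>

lemma jordan_decomposition_le:
  assumes "jordan_decomposition \<nu> Q R" "jordan_decomposition \<nu> Q' R'" "E \<in> sets borel"
  shows "measure Q E \<le> measure Q' E"
proof -
  obtain H where H: "H \<in> sets borel" "measure Q (- H) = 0" "measure R H = 0"
    using assms(1) unfolding jordan_decomposition_def by blast
  interpret Q: finite_measure Q using assms(1) unfolding jordan_decomposition_def by blast
  interpret R: finite_measure R using assms(1) unfolding jordan_decomposition_def by blast
  interpret Q': finite_measure Q' using assms(2) unfolding jordan_decomposition_def by blast
  have [simp]: "sets Q = sets borel" "sets R = sets borel" "sets Q' = sets borel"
    using assms unfolding jordan_decomposition_def by blast+
  have \<nu>: "\<nu> (E \<inter> H) = measure Q (E \<inter> H) - measure R (E \<inter> H)"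
    "\<nu> (E \<inter> H) = measure Q' (E \<inter> H) - measure R' (E \<inter> H)"
    using assms H unfolding jordan_decomposition_def by blast+
  have "measure R (E \<inter> H) \<le> measure R H"
    using H by (intro R.finite_measure_mono) auto
  moreover have "measure Q (E - H) \<le> measure Q (- H)"
    using H by (intro Q.finite_measure_mono) auto
  moreover have "measure Q E = measure Q (E \<inter> H) + measure Q (E - H)"
    using H assms(3) by (subst Q.finite_measure_Union[symmetric]) (auto simp: Int_Diff_Un)
  moreover have "measure Q' (E \<inter> H) \<le> measure Q' E"
    using H assms(3) by (intro Q'.finite_measure_mono) auto
  ultimately show ?thesis
    using \<nu> H measure_nonneg[of R' "E \<inter> H"] measure_nonneg[of R "E \<inter> H"] by linarith
qed

lemma jordan_decomposition_unique:
  assumes J: "jordan_decomposition \<nu> Q R" and J': "jordan_decomposition \<nu> Q' R'"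
  shows "Q = Q'" "R = R'"
proof -
  have finite: "finite_measure Q" "finite_measure R" "finite_measure Q'" "finite_measure R'"
    and sets: "sets Q = sets borel" "sets R = sets borel"
      "sets Q' = sets borel" "sets R' = sets borel"
    using J J' unfolding jordan_decomposition_def by blast+
  have measure_eqI_borel: "M = M'"
    if "finite_measure M" "finite_measure M'" "sets M = sets borel" "sets M' = sets borel"
      "\<And>E. E \<in> sets borel \<Longrightarrow> measure M E = measure M' E" for M M' :: "real measure"
    using that by (intro measure_eqI) (auto simp: finite_measure.emeasure_eq_measure)
  have Q: "measure Q E = measure Q' E" if "E \<in> sets borel" for E
    using jordan_decomposition_le[OF J J' that] jordan_decomposition_le[OF J' J that] by simp
  have "measure R E = measure R' E" if "E \<in> sets borel" for E
  proof -
    have "\<nu> E = measure Q E - measure R E" "\<nu> E = measure Q' E - measure R' E"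
      using J J' that unfolding jordan_decomposition_def by blast+
    then show ?thesis using Q[OF that] by simp
  qed
  with Q show "Q = Q'" "R = R'"
    using finite sets by (auto intro: measure_eqI_borel)
qed

lemma has_real_measure_integral_iff:
  assumes "jordan_decomposition \<nu> Q R"
  shows "has_real_measure_integral \<nu> f I \<longleftrightarrow>
    integrable Q f \<and> integrable R f \<and> I = integral\<^sup>L Q f - integral\<^sup>L R f"
  unfolding has_real_measure_integral_def using assms jordan_decomposition_unique[OF assms] by blast

section \<open>Stieltjes inversion\<close>

definition poisson :: "real \<Rightarrow> real \<Rightarrow> real \<Rightarrow> real" where
  "poisson y x t = y / (pi * ((x - t)\<^sup>2 + y\<^sup>2))"

lemma poisson_nonneg: "y > 0 \<Longrightarrow> poisson y x t \<ge> 0"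
  by (simp add: poisson_def)

lemma poisson_le:
  assumes "y > 0"
  shows "poisson y x t \<le> 1 / (pi * y)"
proof -
  have "pi * y * y \<le> pi * ((x - t)\<^sup>2 + y\<^sup>2)"
    by (simp add: power2_eq_square)
  then show ?thesis
    using assms by (simp add: poisson_def divide_simps add_nonneg_pos)
qed

lemma poisson_eq_Im:
  assumes "y > 0"
  shows "poisson y x t = - Im (1 / (Complex x y - complex_of_real t)) / pi"
  using assms by (simp add: poisson_def Im_divide power2_eq_square cmod_def field_simps)

lemma measurable_poisson [measurable]:
  "(\<lambda>(x, t). poisson y x t) \<in> borel_measurable (borel \<Otimes>\<^sub>M borel)"
  unfolding poisson_def by measurable

lemma set_integral_poisson:
  assumes "y > 0" "c \<le> d"
  shows "(LINT x:{c..d}|lborel. poisson y x t) = (arctan ((d - t) / y) - arctan ((c - t) / y)) / pi"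
proof -
  have "((\<lambda>x. arctan ((x - t) / y) / pi) has_real_derivative poisson y x t) (at x)" for x
  proof -
    have "1 + ((x - t) / y)\<^sup>2 = ((x - t)\<^sup>2 + y\<^sup>2) / y\<^sup>2"
      using assms by (simp add: field_simps)
    then have "inverse (1 + ((x - t) / y)\<^sup>2) * (1 / y) / pi = poisson y x t"
      using assms by (simp add: poisson_def power2_eq_square)
    then show ?thesis
      using assms by (auto intro!: derivative_eq_intros)
  qed
  moreover have "isCont (\<lambda>x. poisson y x t) x" for x
  proof -
    have "(x - t)\<^sup>2 + y\<^sup>2 > 0" using assms by (simp add: add_nonneg_pos)
    then show ?thesis unfolding poisson_def by (intro continuous_intros) auto
  qed
  ultimately have "(LBINT x. poisson y x t * indicator {c..d} x) =
      arctan ((d - t) / y) / pi - arctan ((c - t) / y) / pi"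
    by (intro integral_FTC_Icc_real[OF assms(2)]) auto
  then show ?thesis
    by (simp add: set_lebesgue_integral_def mult.commute diff_divide_distrib)
qed

lemma arctan_scaled_tendsto: "((\<lambda>y. arctan (s / y)) \<longlongrightarrow> sgn s * (pi / 2)) (at_right 0)"
proof -
  consider "s = 0" | "s > 0" | "s < 0" by linarith
  then show ?thesis
  proof cases
    case 2
    then have "filterlim (\<lambda>y. s / y) at_top (at_right 0)"
      unfolding divide_inverse
      by (intro filterlim_tendsto_pos_mult_at_top[OF tendsto_const] filterlim_inverse_at_top_right)
    from filterlim_compose[OF tendsto_arctan_at_top this] show ?thesis
      using 2 by simp
  next
    case 3
    then have "filterlim (\<lambda>y. s / y) at_bot (at_right 0)"
      unfolding divide_inverse
      by (intro filterlim_tendsto_neg_mult_at_bot[OF tendsto_const] filterlim_inverse_at_top_right)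
    from filterlim_compose[OF tendsto_arctan_at_bot this] show ?thesis
      using 3 by simp
  qed simp
qed

lemma set_integral_poisson_tendsto:
  assumes "c < d"
  shows "((\<lambda>y. LINT x:{c..d}|lborel. poisson y x t) \<longlongrightarrow>
    (indicator {c..d} t + indicator {c<..<d} t) / 2) (at_right 0)"
proof -
  have "((\<lambda>y. (arctan ((d - t) / y) - arctan ((c - t) / y)) / pi) \<longlongrightarrow>
      (sgn (d - t) * (pi / 2) - sgn (c - t) * (pi / 2)) / pi) (at_right 0)"
    by (intro tendsto_intros arctan_scaled_tendsto) simp
  also have "(sgn (d - t) * (pi / 2) - sgn (c - t) * (pi / 2)) / pi =
      (indicator {c..d} t + indicator {c<..<d} t) / 2"
    using assms by (auto simp: sgn_if indicator_def field_simps)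
  finally show ?thesis
    by (rule Lim_transform_eventually)
      (use eventually_at_right_less[of 0] in eventually_elim,
        simp add: set_integral_poisson less_imp_le[OF assms])
qed

context
  fixes Q :: "real measure"
  assumes finite_Q: "finite_measure Q" and sets_Q [measurable_cong, simp]: "sets Q = sets borel"
begin

interpretation finite_measure Q by (rule finite_Q)

lemma integrable_poisson:
  assumes "y > 0"
  shows "integrable Q (poisson y x)"
proof (rule integrable_const_bound)
  show "AE t in Q. norm (poisson y x t) \<le> 1 / (pi * y)"
    using assms by (simp add: poisson_nonneg poisson_le)
qed measurable

lemma set_integrable_poisson_transform:
  assumes "y > 0"
  shows "set_integrable lborel {c..d} (\<lambda>x. LINT t|Q. poisson y x t)"
proof (rule set_integrable_bound)
  show "set_integrable lborel {c..d} (\<lambda>x. 1 / (pi * y) * measure Q (space Q))"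
    by (intro borel_integrable_atLeastAtMost' continuous_intros)
  have "norm (LINT t|Q. poisson y x t) \<le> (LINT t|Q. 1 / (pi * y))" for x
    using assms by (intro Bochner_Integration.integral_norm_bound_integral integrable_poisson)
      (simp_all add: poisson_nonneg poisson_le)
  then show "AE x in lborel. x \<in> {c..d} \<longrightarrow>
      norm (LINT t|Q. poisson y x t) \<le> norm (1 / (pi * y) * measure Q (space Q))"
    using assms by (simp add: mult.commute)
qed (simp add: set_borel_measurable_def)

lemma set_integral_poisson_transform:
  assumes "y > 0"
  shows "(LINT x:{c..d}|lborel. (LINT t|Q. poisson y x t)) =
    (LINT t|Q. (LINT x:{c..d}|lborel. poisson y x t))"
proof -
  interpret pair_sigma_finite lborel Q ..
  let ?f = "\<lambda>(x, t). indicator {c..d} x * poisson y x t"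
  have "integrable (lborel \<Otimes>\<^sub>M Q) ?f"
  proof (rule Fubini_integrable)
    show "?f \<in> borel_measurable (lborel \<Otimes>\<^sub>M Q)"
      by measurable
    show "integrable lborel (\<lambda>x. LINT t|Q. norm (?f (x, t)))"
      using set_integrable_poisson_transform[OF assms, of c d] assms
      by (simp add: set_integrable_def abs_mult poisson_nonneg)
    show "AE x in lborel. integrable Q (\<lambda>t. ?f (x, t))"
      using assms by (simp add: integrable_poisson)
  qed
  from Fubini_integral[OF this] show ?thesis
    by (simp add: set_lebesgue_integral_def)
qed

lemma poisson_transform_tendsto:
  assumes "c < d"
  shows "((\<lambda>y. LINT x:{c..d}|lborel. (LINT t|Q. poisson y x t)) \<longlongrightarrow>
    (measure Q {c..d} + measure Q {c<..<d}) / 2) (at_right 0)"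
proof (rule tendsto_at_right_sequentially[of 0 1])
  fix S :: "nat \<Rightarrow> real"
  assume S: "\<And>n. 0 < S n" "S \<longlonglongrightarrow> 0"
  then have S_lim: "filterlim S (at_right 0) sequentially"
    by (intro tendsto_imp_filterlim_at_right) auto
  have "(\<lambda>n. LINT t|Q. (LINT x:{c..d}|lborel. poisson (S n) x t)) \<longlonglongrightarrow>
      (LINT t|Q. (indicator {c..d} t + indicator {c<..<d} t) / 2)"
  proof (rule integral_dominated_convergence[where w = "\<lambda>_. 1"])
    show "AE t in Q. (\<lambda>n. LINT x:{c..d}|lborel. poisson (S n) x t) \<longlonglongrightarrow>
        (indicator {c..d} t + indicator {c<..<d} t) / 2"
      using filterlim_compose[OF set_integral_poisson_tendsto[OF assms] S_lim] by simp
    show "AE t in Q. norm (LINT x:{c..d}|lborel. poisson (S n) x t) \<le> 1" for n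
    proof (rule AE_I2)
      fix t
      have "\<bar>arctan ((d - t) / S n) - arctan ((c - t) / S n)\<bar> \<le> pi"
        using arctan_bounded[of "(d - t) / S n"] arctan_bounded[of "(c - t) / S n"] by linarith
      then show "norm (LINT x:{c..d}|lborel. poisson (S n) x t) \<le> 1"
        using assms S(1)[of n] by (simp add: set_integral_poisson)
    qed
    show "(\<lambda>t. LINT x:{c..d}|lborel. poisson (S n) x t) \<in> borel_measurable Q" for n
      using assms S(1)[of n] by (simp add: set_integral_poisson)
  qed simp_all
  then show "(\<lambda>n. LINT x:{c..d}|lborel. (LINT t|Q. poisson (S n) x t)) \<longlonglongrightarrow>
      (measure Q {c..d} + measure Q {c<..<d}) / 2"
    by (simp add: set_integral_poisson_transform[OF S(1)] emeasure_finite less_top[symmetric])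
qed simp

end

definition boundary_dominated :: "(complex \<Rightarrow> complex) \<Rightarrow> bool" where
  "boundary_dominated G \<longleftrightarrow> (\<forall>c d. \<exists>w. set_integrable lborel {c..d} w \<and>
     (AE x in lborel. x \<in> {c..d} \<longrightarrow> (\<forall>y\<in>{0<..1}. cmod (G (Complex x y)) \<le> w x)))"

lemma boundary_dominatedE:
  assumes "boundary_dominated G"
  obtains w where "set_integrable lborel {c..d} w"
    "AE x in lborel. x \<in> {c..d} \<longrightarrow> (\<forall>y\<in>{0<..1}. cmod (G (Complex x y)) \<le> w x)"
  using assms unfolding boundary_dominated_def by blast

lemma Im_cauchy_transform_eq_poisson_transform:
  assumes J: "jordan_decomposition \<nu> Q R" and "y > 0"
    and I: "has_real_measure_integral \<nu> (\<lambda>t. 1 / (Complex x y - complex_of_real t)) I"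
  shows "- Im I / pi = (LINT t|Q. poisson y x t) - (LINT t|R. poisson y x t)"
proof -
  let ?f = "\<lambda>t. 1 / (Complex x y - complex_of_real t)"
  have int: "integrable Q ?f" "integrable R ?f" and "I = integral\<^sup>L Q ?f - integral\<^sup>L R ?f"
    using I by (simp_all add: has_real_measure_integral_iff[OF J])
  then have "- Im I / pi = - Im (integral\<^sup>L Q ?f) / pi - (- Im (integral\<^sup>L R ?f) / pi)"
    by (simp add: diff_divide_distrib)
  also have "\<dots> = (LINT t|Q. poisson y x t) - (LINT t|R. poisson y x t)"
    unfolding poisson_eq_Im[OF \<open>y > 0\<close>] using int by (simp del: Im_divide_of_real)
  finally show ?thesis .
qed

lemma stieltjes_inversion:
  assumes J: "jordan_decomposition \<nu> Q R" and "c < d"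
    and G: "\<And>z. z \<notin> \<real> \<Longrightarrow> has_real_measure_integral \<nu> (\<lambda>x. 1 / (z - complex_of_real x)) (G z)"
  shows "\<And>y. y > 0 \<Longrightarrow> set_integrable lborel {c..d} (\<lambda>x. - Im (G (Complex x y)) / pi)"
    and "((\<lambda>y. LINT x:{c..d}|lborel. - Im (G (Complex x y)) / pi) \<longlongrightarrow>
      (\<nu> {c..d} + \<nu> {c<..<d}) / 2) (at_right 0)"
proof -
  have Q: "finite_measure Q" "sets Q = sets borel" and R: "finite_measure R" "sets R = sets borel"
    using J unfolding jordan_decomposition_def by blast+
  have poisson: "- Im (G (Complex x y)) / pi =
      (LINT t|Q. poisson y x t) - (LINT t|R. poisson y x t)" if "y > 0" for x y
    using that by (intro Im_cauchy_transform_eq_poisson_transform[OF J] G)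
      (simp_all add: complex_is_Real_iff)
  note int = set_integrable_poisson_transform[OF Q] set_integrable_poisson_transform[OF R]
  show "set_integrable lborel {c..d} (\<lambda>x. - Im (G (Complex x y)) / pi)" if "y > 0" for y
    unfolding poisson[OF that] using int that by (intro set_integral_diff)
  have "((\<lambda>y. (LINT x:{c..d}|lborel. (LINT t|Q. poisson y x t)) -
      (LINT x:{c..d}|lborel. (LINT t|R. poisson y x t))) \<longlongrightarrow>
      (measure Q {c..d} + measure Q {c<..<d}) / 2 - (measure R {c..d} + measure R {c<..<d}) / 2)
      (at_right 0)"
    using Q R \<open>c < d\<close> by (intro tendsto_diff poisson_transform_tendsto)
  also have "(measure Q {c..d} + measure Q {c<..<d}) / 2 -
      (measure R {c..d} + measure R {c<..<d}) / 2 = (\<nu> {c..d} + \<nu> {c<..<d}) / 2"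
    using J by (simp add: jordan_decomposition_def diff_divide_distrib add_divide_distrib)
  finally show "((\<lambda>y. LINT x:{c..d}|lborel. - Im (G (Complex x y)) / pi) \<longlongrightarrow>
      (\<nu> {c..d} + \<nu> {c<..<d}) / 2) (at_right 0)"
    by (rule Lim_transform_eventually)
      (use eventually_at_right_less[of 0] in eventually_elim,
        simp only: poisson int set_integral_diff(2))
qed

lemma abs_Im_over_pi_le: "\<bar>- Im w / pi\<bar> \<le> cmod w"
proof -
  have "\<bar>Im w\<bar> / pi \<le> \<bar>Im w\<bar> / 1"
    using pi_gt3 by (intro divide_left_mono) auto
  then show ?thesis
    using abs_Im_le_cmod[of w] by simp
qed

lemma boundary_value_set_integrable:
  assumes G: "boundary_dominated G" and \<rho>: "\<rho> \<in> borel_measurable borel"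
    and lim: "AE x in lborel. ((\<lambda>y. - Im (G (Complex x y)) / pi) \<longlongrightarrow> \<rho> x) (at_right 0)"
  shows "set_integrable lborel {c..d} \<rho>"
proof -
  obtain w where w: "set_integrable lborel {c..d} w"
    and bound: "AE x in lborel. x \<in> {c..d} \<longrightarrow> (\<forall>y\<in>{0<..1}. cmod (G (Complex x y)) \<le> w x)"
    using boundary_dominatedE[OF G] by blast
  show ?thesis
  proof (rule set_integrable_bound[OF w])
    show "AE x in lborel. x \<in> {c..d} \<longrightarrow> norm (\<rho> x) \<le> norm (w x)"
      using lim bound
    proof eventually_elim
      case (elim x)
      have "\<bar>\<rho> x\<bar> \<le> w x" if "x \<in> {c..d}"
      proof (rule tendsto_upperbound[OF tendsto_rabs[OF elim(1)]])
        have "\<bar>- Im (G (Complex x y)) / pi\<bar> \<le> w x" if "y \<in> {0<..<1}" for y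
          using elim(2) \<open>x \<in> {c..d}\<close> that
          by (intro order_trans[OF abs_Im_over_pi_le]) auto
        then show "\<forall>\<^sub>F y in at_right 0. \<bar>- Im (G (Complex x y)) / pi\<bar> \<le> w x"
          by (intro eventually_at_rightI[of 0 1]) auto
      qed simp
      then show ?case by auto
    qed
  qed (use \<rho> in \<open>simp add: set_borel_measurable_def\<close>)
qed

lemma tendsto_set_integral_boundary_value:
  assumes G: "boundary_dominated G" and \<rho>: "\<rho> \<in> borel_measurable borel"
    and lim: "AE x in lborel. ((\<lambda>y. - Im (G (Complex x y)) / pi) \<longlongrightarrow> \<rho> x) (at_right 0)"
    and int: "\<And>y. y > 0 \<Longrightarrow> set_integrable lborel {c..d} (\<lambda>x. - Im (G (Complex x y)) / pi)"
  shows "((\<lambda>y. LINT x:{c..d}|lborel. - Im (G (Complex x y)) / pi) \<longlongrightarrow>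
    (LINT x:{c..d}|lborel. \<rho> x)) (at_right 0)"
proof (rule tendsto_at_right_sequentially[of 0 1])
  fix S :: "nat \<Rightarrow> real"
  assume S: "\<And>n. 0 < S n" "\<And>n. S n < 1" "S \<longlonglongrightarrow> 0"
  then have S_lim: "filterlim S (at_right 0) sequentially"
    by (intro tendsto_imp_filterlim_at_right) auto
  obtain w where w: "set_integrable lborel {c..d} w"
    and bound: "AE x in lborel. x \<in> {c..d} \<longrightarrow> (\<forall>y\<in>{0<..1}. cmod (G (Complex x y)) \<le> w x)"
    using boundary_dominatedE[OF G] by blast
  show "(\<lambda>n. LINT x:{c..d}|lborel. - Im (G (Complex x (S n))) / pi) \<longlonglongrightarrow> (LINT x:{c..d}|lborel. \<rho> x)"
    unfolding set_lebesgue_integral_def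
  proof (rule integral_dominated_convergence)
    show "integrable lborel (\<lambda>x. indicator {c..d} x *\<^sub>R w x)"
      using w by (simp add: set_integrable_def)
    show "(\<lambda>x. indicator {c..d} x *\<^sub>R \<rho> x) \<in> borel_measurable lborel"
      using \<rho> by measurable
    show "(\<lambda>x. indicator {c..d} x *\<^sub>R (- Im (G (Complex x (S n))) / pi))
        \<in> borel_measurable lborel" for n
      using int[OF S(1)[of n]] by (auto simp: set_integrable_def dest: borel_measurable_integrable)
    show "AE x in lborel. (\<lambda>n. indicator {c..d} x *\<^sub>R (- Im (G (Complex x (S n))) / pi))
        \<longlonglongrightarrow> indicator {c..d} x *\<^sub>R \<rho> x"
      using lim
      by eventually_elim (intro tendsto_scaleR tendsto_const filterlim_compose[OF _ S_lim])
    show "AE x in lborel. norm (indicator {c..d} x *\<^sub>R (- Im (G (Complex x (S n))) / pi))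
        \<le> indicator {c..d} x *\<^sub>R w x" for n
      using bound
    proof eventually_elim
      case (elim x)
      have "S n \<in> {0<..1}" using S(1,2)[of n] by simp
      with elim abs_Im_over_pi_le[of "G (Complex x (S n))"] show ?case
        by (cases "x \<in> {c..d}") (auto intro: order_trans)
    qed
  qed
qed simp

theorem stieltjes_density:
  assumes \<nu>: "finite_real_measure \<nu>"
    and G: "\<And>z. z \<notin> \<real> \<Longrightarrow> has_real_measure_integral \<nu> (\<lambda>x. 1 / (z - complex_of_real x)) (G z)"
    and dom: "boundary_dominated G"
    and \<rho>: "\<rho> \<in> borel_measurable borel" and supp: "bounded {x. \<rho> x \<noteq> 0}"
    and lim: "AE x in lborel. ((\<lambda>y. - Im (G (Complex x y)) / pi) \<longlongrightarrow> \<rho> x) (at_right 0)"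
  shows "absolutely_continuous_with_density \<nu> \<rho>"
proof -
  have int: "integrable lborel \<rho>"
  proof -
    obtain c d where "{x. \<rho> x \<noteq> 0} \<subseteq> {c..d}"
      using bounded_subset_cbox_symmetric[OF supp] by (metis cbox_interval)
    then have "indicator {c..d} x *\<^sub>R \<rho> x = \<rho> x" for x
      by (auto simp: indicator_def)
    with boundary_value_set_integrable[OF dom \<rho> lim, of c d] show ?thesis
      by (simp only: set_integrable_def)
  qed
  have "\<i> \<notin> \<real>" by (simp add: complex_is_Real_iff)
  from G[OF this] obtain Q R where J: "jordan_decomposition \<nu> Q R"
    unfolding has_real_measure_integral_def by blast
  let ?\<delta> = "\<lambda>E. \<nu> E - (LINT x:E|lborel. \<rho> x)"
  have "?\<delta> {c..d} + ?\<delta> {c<..<d} = 0" if "c < d" for c d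
  proof -
    note inversion = stieltjes_inversion[OF J that G]
    have "(\<nu> {c..d} + \<nu> {c<..<d}) / 2 = (LINT x:{c..d}|lborel. \<rho> x)"
      by (rule tendsto_unique[OF trivial_limit_at_right_real inversion(2)
            tendsto_set_integral_boundary_value[OF dom \<rho> lim inversion(1)]])
    moreover have "(LINT x:{c<..<d}|lborel. \<rho> x) = (LINT x:{c..d}|lborel. \<rho> x)"
      by (rule set_integral_discrete_difference[where X = "{c, d}"]) auto
    ultimately show ?thesis by simp
  qed
  then have "?\<delta> E = 0" if "E \<in> sets borel" for E
    using finite_real_measure_eq_0_intervals[OF
        finite_real_measure_diff[OF \<nu> finite_real_measure_set_integral[OF int]] _ that]
    by blast
  with int show ?thesis
    by (simp add: absolutely_continuous_with_density_def)
qed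

section \<open>Domination near the real axis\<close>

lemma AE_poly_nonzero:
  fixes p :: "real poly"
  assumes "p \<noteq> 0"
  shows "AE x in lborel. poly p x \<noteq> 0"
  using AE_not_in[OF finite_imp_null_set_lborel[OF poly_roots_finite[OF assms]]] by simp

lemma boundary_dominated_cong:
  assumes "boundary_dominated G" "\<And>z. Im z > 0 \<Longrightarrow> F z = G z"
  shows "boundary_dominated F"
  using assms by (simp add: boundary_dominated_def)

lemma boundary_dominated_add:
  assumes "boundary_dominated F" "boundary_dominated G"
  shows "boundary_dominated (\<lambda>z. F z + G z)"
  unfolding boundary_dominated_def
proof (intro allI)
  fix c d
  obtain v where v: "set_integrable lborel {c..d} v"
    "AE x in lborel. x \<in> {c..d} \<longrightarrow> (\<forall>y\<in>{0<..1}. cmod (F (Complex x y)) \<le> v x)"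
    using boundary_dominatedE[OF assms(1)] by blast
  obtain w where w: "set_integrable lborel {c..d} w"
    "AE x in lborel. x \<in> {c..d} \<longrightarrow> (\<forall>y\<in>{0<..1}. cmod (G (Complex x y)) \<le> w x)"
    using boundary_dominatedE[OF assms(2)] by blast
  have "AE x in lborel. x \<in> {c..d} \<longrightarrow>
      (\<forall>y\<in>{0<..1}. cmod (F (Complex x y) + G (Complex x y)) \<le> v x + w x)"
    using v(2) w(2) by eventually_elim (blast intro: norm_triangle_le add_mono)
  with set_integral_add(1)[OF v(1) w(1)]
  show "\<exists>w. set_integrable lborel {c..d} w \<and> (AE x in lborel. x \<in> {c..d} \<longrightarrow>
      (\<forall>y\<in>{0<..1}. cmod (F (Complex x y) + G (Complex x y)) \<le> w x))"
    by blast
qed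

lemma boundary_dominated_cpoly: "boundary_dominated (cpoly p)"
  unfolding boundary_dominated_def
proof (intro allI)
  fix c d
  obtain B where "\<And>x y. x \<in> {c..d} \<Longrightarrow> y \<in> {0<..1} \<Longrightarrow> cmod (cpoly p (Complex x y)) \<le> B"
    using cpoly_bounded_rectangle by blast
  moreover have "set_integrable lborel {c..d} (\<lambda>x. B)"
    by (intro borel_integrable_atLeastAtMost' continuous_intros)
  ultimately show "\<exists>w. set_integrable lborel {c..d} w \<and>
      (AE x in lborel. x \<in> {c..d} \<longrightarrow> (\<forall>y\<in>{0<..1}. cmod (cpoly p (Complex x y)) \<le> w x))"
    by (intro exI[of _ "\<lambda>x. B"]) auto
qed

lemma boundary_dominated_cpoly_mult:
  assumes "boundary_dominated G"
  shows "boundary_dominated (\<lambda>z. cpoly p z * G z)"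
  unfolding boundary_dominated_def
proof (intro allI)
  fix c d
  obtain B where B: "\<And>x y. x \<in> {c..d} \<Longrightarrow> y \<in> {0<..1} \<Longrightarrow> cmod (cpoly p (Complex x y)) \<le> B"
    using cpoly_bounded_rectangle by blast
  obtain w where w: "set_integrable lborel {c..d} w"
    "AE x in lborel. x \<in> {c..d} \<longrightarrow> (\<forall>y\<in>{0<..1}. cmod (G (Complex x y)) \<le> w x)"
    using boundary_dominatedE[OF assms] by blast
  have "AE x in lborel. x \<in> {c..d} \<longrightarrow>
      (\<forall>y\<in>{0<..1}. cmod (cpoly p (Complex x y) * G (Complex x y)) \<le> B * w x)"
    using w(2)
  proof eventually_elim
    case (elim x)
    show ?case
    proof (intro impI ballI)
      fix y assume "x \<in> {c..d}" "y \<in> {0<..1::real}"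
      then show "cmod (cpoly p (Complex x y) * G (Complex x y)) \<le> B * w x"
        unfolding norm_mult using elim B[of x y] order_trans[OF norm_ge_zero B[of x y]]
        by (intro mult_mono) auto
    qed
  qed
  with set_integrable_mult_right[of B, OF w(1)]
  show "\<exists>w. set_integrable lborel {c..d} w \<and> (AE x in lborel. x \<in> {c..d} \<longrightarrow>
      (\<forall>y\<in>{0<..1}. cmod (cpoly p (Complex x y) * G (Complex x y)) \<le> w x))"
    by blast
qed

lemma boundary_dominated_sqrt_quotient:
  assumes q: "real_rooted q" "rsquarefree q"
    and square: "\<And>z. Im z > 0 \<Longrightarrow> (G z)\<^sup>2 = cpoly p z / cpoly q z"
  shows "boundary_dominated G"
  unfolding boundary_dominated_def
proof (intro allI)
  fix c d
  obtain B where B: "\<And>x y. x \<in> {c..d} \<Longrightarrow> y \<in> {0<..1} \<Longrightarrow> cmod (cpoly p (Complex x y)) \<le> B"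
    using cpoly_bounded_rectangle by blast
  let ?w = "\<lambda>x. sqrt B * (1 / sqrt \<bar>poly q x\<bar>)"
  have "cmod (G (Complex x y)) \<le> ?w x" if "poly q x \<noteq> 0" "x \<in> {c..d}" "y \<in> {0<..1}" for x y
  proof -
    let ?z = "Complex x y"
    have "(cmod (G ?z))\<^sup>2 = cmod (cpoly p ?z) / cmod (cpoly q ?z)"
      using square[of ?z] that by (simp add: norm_divide flip: norm_power)
    then have "cmod (G ?z) = sqrt (cmod (cpoly p ?z) / cmod (cpoly q ?z))"
      by (metis norm_ge_zero real_sqrt_unique)
    also have "\<dots> \<le> sqrt (B / \<bar>poly q x\<bar>)"
      using that order_trans[OF norm_ge_zero B]
      by (intro real_sqrt_le_mono frac_le B abs_poly_le_cmod_cpoly[OF q(1)]) auto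
    finally show ?thesis by (simp add: real_sqrt_divide)
  qed
  then have "AE x in lborel. x \<in> {c..d} \<longrightarrow> (\<forall>y\<in>{0<..1}. cmod (G (Complex x y)) \<le> ?w x)"
    using AE_poly_nonzero[of q] q(2) by (auto simp: rsquarefree_def elim: eventually_mono)
  moreover have "set_integrable lborel {c..d} ?w"
    by (intro set_integrable_mult_right set_integrable_inverse_sqrt_poly q)
  ultimately show "\<exists>w. set_integrable lborel {c..d} w \<and>
      (AE x in lborel. x \<in> {c..d} \<longrightarrow> (\<forall>y\<in>{0<..1}. cmod (G (Complex x y)) \<le> w x))"
    by blast
qed

section \<open>Boundary values of square roots\<close>

text \<open>The sign of the imaginary part selects the branch of the square root.\<close>

lemma tendsto_Im_of_square:
  fixes X :: "'a \<Rightarrow> complex"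
  assumes lim: "((\<lambda>y. (X y)\<^sup>2) \<longlongrightarrow> of_real t) F" and neg: "\<forall>\<^sub>F y in F. Im (X y) \<le> 0"
  shows "((\<lambda>y. Im (X y)) \<longlongrightarrow> - sqrt ((\<bar>t\<bar> - t) / 2)) F"
proof -
  have "((\<lambda>y. - sqrt ((cmod ((X y)\<^sup>2) - Re ((X y)\<^sup>2)) / 2)) \<longlongrightarrow>
      - sqrt ((cmod (of_real t) - Re (of_real t)) / 2)) F"
    by (intro tendsto_intros lim) simp
  also have "- sqrt ((cmod (of_real t) - Re (of_real t)) / 2) = - sqrt ((\<bar>t\<bar> - t) / 2)"
    by simp
  finally show ?thesis
  proof (rule Lim_transform_eventually)
    show "\<forall>\<^sub>F y in F. - sqrt ((cmod ((X y)\<^sup>2) - Re ((X y)\<^sup>2)) / 2) = Im (X y)"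
      using neg
    proof eventually_elim
      case (elim y)
      have "(cmod ((X y)\<^sup>2) - Re ((X y)\<^sup>2)) / 2 = (Im (X y))\<^sup>2"
        by (simp add: norm_power cmod_power2) (simp add: power2_eq_square)
      with elim show ?case by simp
    qed
  qed
qed

context
  fixes G :: "complex \<Rightarrow> complex" and p q :: "real poly" and x :: real
  assumes square: "\<And>z. Im z > 0 \<Longrightarrow> (G z)\<^sup>2 = (cpoly p z)\<^sup>2 / cpoly q z"
    and q: "poly q x \<noteq> 0"
begin

lemma square_boundary_value:
  "((\<lambda>y. (G (Complex x y))\<^sup>2) \<longlongrightarrow> of_real ((poly p x)\<^sup>2 / poly q x)) (at_right 0)"
proof -
  have "((\<lambda>y. (cpoly p (Complex x y))\<^sup>2 / cpoly q (Complex x y)) \<longlongrightarrow>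
      (of_real (poly p x))\<^sup>2 / of_real (poly q x)) (at_right 0)"
    using q by (intro tendsto_intros tendsto_cpoly_vertical)
      (simp only: of_real_eq_0_iff not_False_eq_True)
  then have "((\<lambda>y. (cpoly p (Complex x y))\<^sup>2 / cpoly q (Complex x y)) \<longlongrightarrow>
      of_real ((poly p x)\<^sup>2 / poly q x)) (at_right 0)"
    by simp
  then show ?thesis
    by (rule Lim_transform_eventually)
      (use eventually_at_right_less[of 0] in eventually_elim, simp add: square)
qed

lemma Im_boundary_value:
  assumes "\<And>z. Im z > 0 \<Longrightarrow> Im (G z) \<le> 0"
  shows "((\<lambda>y. Im (G (Complex x y))) \<longlongrightarrow>
    - (if poly q x < 0 then \<bar>poly p x\<bar> / sqrt (- poly q x) else 0)) (at_right 0)"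
proof -
  let ?t = "(poly p x)\<^sup>2 / poly q x"
  have "((\<lambda>y. Im (G (Complex x y))) \<longlongrightarrow> - sqrt ((\<bar>?t\<bar> - ?t) / 2)) (at_right 0)"
    by (rule tendsto_Im_of_square[OF square_boundary_value])
      (use eventually_at_right_less[of 0] in eventually_elim, simp add: assms)
  moreover have "sqrt ((\<bar>?t\<bar> - ?t) / 2) =
      (if poly q x < 0 then \<bar>poly p x\<bar> / sqrt (- poly q x) else 0)"
  proof (cases "poly q x < 0")
    case True
    then have "(\<bar>?t\<bar> - ?t) / 2 = (poly p x)\<^sup>2 / (- poly q x)"
      by (simp add: abs_if divide_less_0_iff)
    then show ?thesis
      using True by (simp only: real_sqrt_divide real_sqrt_abs if_True)
  qed (use q in simp)
  ultimately show ?thesis by simp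
qed

lemma vertical_times_Re_tendsto_0: "((\<lambda>y. y * Re (G (Complex x y))) \<longlongrightarrow> 0) (at_right 0)"
proof (rule Lim_null_comparison)
  have "((\<lambda>y. y * sqrt (cmod ((G (Complex x y))\<^sup>2))) \<longlongrightarrow>
      0 * sqrt (cmod (of_real ((poly p x)\<^sup>2 / poly q x)))) (at_right 0)"
    by (intro tendsto_intros square_boundary_value)
  then show "((\<lambda>y. y * sqrt (cmod ((G (Complex x y))\<^sup>2))) \<longlongrightarrow> 0) (at_right 0)"
    by simp
  show "\<forall>\<^sub>F y in at_right 0.
      norm (y * Re (G (Complex x y))) \<le> y * sqrt (cmod ((G (Complex x y))\<^sup>2))"
    using eventually_at_right_less[of 0]
    by eventually_elim (simp add: abs_mult norm_power abs_Re_le_cmod)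
qed

end

section \<open>Even periodic potentials\<close>

lemma confluent_christoffel_darboux:
  assumes "is_solution (\<lambda>n. [:b n :: 'a::idom:]) [:0, 1:] u"
  shows "wronskian u (\<lambda>k. pderiv (u k)) (int n) =
    wronskian u (\<lambda>k. pderiv (u k)) 0 + 2 * (\<Sum>k=1..n. (u (int k))\<^sup>2)"
proof (induction n)
  case (Suc n)
  define X where "X = 2 * ([:0, 1:] - [:b (int (Suc n)):])"
  have succ: "u (int (Suc n) + 1) = X * u (int (Suc n)) - u (int n)"
    using solution_succ[OF assms, of "int (Suc n)"] by (simp add: X_def)
  have "pderiv X = 2"
    by (simp add: X_def pderiv_mult pderiv_diff pderiv_pCons pderiv_smult numeral_poly)
  then have deriv: "pderiv (u (int (Suc n) + 1)) =
      2 * u (int (Suc n)) + X * pderiv (u (int (Suc n))) - pderiv (u (int n))"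
    unfolding succ pderiv_diff pderiv_mult by simp
  have "int n + 1 = int (Suc n)" by simp
  then have "wronskian u (\<lambda>k. pderiv (u k)) (int (Suc n)) =
      wronskian u (\<lambda>k. pderiv (u k)) (int n) + 2 * (u (int (Suc n)))\<^sup>2"
    unfolding wronskian_def deriv by (simp only: succ) (simp only: algebra_simps power2_eq_square)
  with Suc show ?case by (simp add: algebra_simps)
qed simp

context even_periodic_potential
begin

abbreviation bp :: "int \<Rightarrow> real poly" where
  "bp \<equiv> \<lambda>n. [:b n:]"

sublocale poly: even_periodic bp N
  by unfold_locales (simp_all add: period_pos even periodic)

abbreviation even_poly :: "int \<Rightarrow> real poly" where
  "even_poly \<equiv> even_sol bp [:0, 1:]"

abbreviation odd_poly :: "int \<Rightarrow> real poly" where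
  "odd_poly \<equiv> odd_sol bp [:0, 1:]"

abbreviation shift_coeff_poly :: "real poly" where
  "shift_coeff_poly \<equiv> even_shift_coeff bp N [:0, 1:]"

lemma poly_even_poly: "poly (even_poly n) x = even_sol b x n"
  by (simp add: poly_hom.even_sol_hom)

lemma cpoly_even_poly: "cpoly (even_poly n) z = even_sol bc z n"
  and cpoly_odd_poly: "cpoly (odd_poly n) z = odd_sol bc z n"
  by (simp_all add: cpoly_hom.even_sol_hom cpoly_hom.odd_sol_hom)

lemma cpoly_shift_coeff_poly: "cpoly shift_coeff_poly z = even_shift_coeff bc N z"
  by (simp add: even_shift_coeff_def cpoly_hom.hom_diff cpoly_even_poly algebra_simps)

lemma real_rooted_odd_poly: "real_rooted (odd_poly (int N))"
  and real_rooted_shift_coeff_poly: "real_rooted shift_coeff_poly"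
  using odd_sol_period_nonzero even_shift_coeff_nonzero
  by (auto simp: real_rooted_def cpoly_odd_poly cpoly_shift_coeff_poly)

lemma rsquarefree_odd_poly: "rsquarefree (odd_poly (int N))"
  unfolding rsquarefree_roots
proof (intro allI notI, elim conjE)
  fix x
  let ?s = "\<lambda>k. poly (odd_poly (int k)) x"
  assume root: "?s N = 0" "poly (pderiv (odd_poly (int N))) x = 0"
  have "(\<Sum>k=1..N. (?s k)\<^sup>2) = 0"
    using arg_cong[OF confluent_christoffel_darboux[OF is_solution_odd_sol, of b N],
        of "\<lambda>p. poly p x"] root
    by (simp add: wronskian_def poly_sum)
  then have "(?s k)\<^sup>2 = 0" if "k \<in> {1..N}" for k
    using that by (subst (asm) sum_nonneg_eq_0_iff) auto
  from this[of 1] show False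
    using period_pos by simp
qed

lemma shift_coeff_poly_christoffel_darboux:
  "even_poly (int N) * pderiv shift_coeff_poly - shift_coeff_poly * pderiv (even_poly (int N)) +
    (even_poly (int N))\<^sup>2 = 1 + 2 * (\<Sum>k=1..N. (even_poly (int k))\<^sup>2)"
proof -
  define X where "X = [:0, 1:] - bp 0"
  have succ: "even_poly (int N + 1) = shift_coeff_poly + X * even_poly (int N)"
    by (simp add: even_shift_coeff_def X_def)
  have "pderiv X = 1"
    by (simp add: X_def pderiv_diff pderiv_pCons one_pCons)
  then have deriv: "pderiv (even_poly (int N + 1)) =
      pderiv shift_coeff_poly + even_poly (int N) + X * pderiv (even_poly (int N))"
    unfolding succ pderiv_add pderiv_mult by simp
  have "wronskian even_poly (\<lambda>k. pderiv (even_poly k)) (int N) =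
      even_poly (int N) * pderiv shift_coeff_poly - shift_coeff_poly * pderiv (even_poly (int N)) +
      (even_poly (int N))\<^sup>2"
    unfolding wronskian_def deriv by (simp only: succ) (simp only: algebra_simps power2_eq_square)
  moreover have "wronskian even_poly (\<lambda>k. pderiv (even_poly k)) 0 = 1"
    by (simp add: wronskian_def pderiv_pCons one_pCons)
  ultimately show ?thesis
    using confluent_christoffel_darboux[OF is_solution_even_sol, of b N] by simp
qed

lemma rsquarefree_shift_coeff_poly: "rsquarefree shift_coeff_poly"
  unfolding rsquarefree_roots
proof (intro allI notI, elim conjE)
  fix x
  let ?c = "\<lambda>k. poly (even_poly (int k)) x"
  assume root: "poly shift_coeff_poly x = 0" "poly (pderiv shift_coeff_poly) x = 0"
  have "poly ((even_poly (int N))\<^sup>2 - 1) x = 0"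
    unfolding poly.even_sol_square_minus_1 using root by simp
  then have c_N: "(?c N)\<^sup>2 = 1" by simp
  have "(?c N)\<^sup>2 = 1 + 2 * (\<Sum>k=1..N. (?c k)\<^sup>2)"
    using arg_cong[OF shift_coeff_poly_christoffel_darboux, of "\<lambda>p. poly p x"] root
    by (simp add: poly_sum)
  with c_N have "(\<Sum>k=1..N. (?c k)\<^sup>2) = 0" by simp
  then have "(?c N)\<^sup>2 = 0"
    using period_pos by (subst (asm) sum_nonneg_eq_0_iff) auto
  with c_N show False by simp
qed

lemma degree_even_poly: "degree (even_poly (int n)) = n"
proof (induction n rule: induct_nat_012)
  case (ge2 n)
  let ?l = "2 * ([:0, 1:] - bp (int (Suc n))) :: real poly"
  have succ: "even_poly (int (Suc (Suc n))) = ?l * even_poly (int (Suc n)) - even_poly (int n)"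
    by (rule solution_Suc_Suc[OF is_solution_even_sol])
  have "degree ?l = 1"
    by (simp add: numeral_poly)
  moreover have "?l \<noteq> 0" "even_poly (int (Suc n)) \<noteq> 0"
    using ge2 \<open>degree ?l = 1\<close> by (metis degree_0 nat.distinct(1) One_nat_def)+
  ultimately have "degree (?l * even_poly (int (Suc n))) = Suc (Suc n)"
    using ge2 by (simp add: degree_mult_eq)
  then show ?case
    unfolding succ diff_conv_add_uminus using ge2 by (subst degree_add_eq_left) auto
qed simp_all

lemma boundary_dominated_green:
  "boundary_dominated (green b 0 0)" "boundary_dominated (green b 0 1)"
  "boundary_dominated (green b 1 1)"
proof -
  let ?l = "[:- b 0, 1:]"
  show G: "boundary_dominated (green b 0 0)"
    using real_rooted_shift_coeff_poly rsquarefree_shift_coeff_poly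
    by (rule boundary_dominated_sqrt_quotient[where p = "odd_poly (int N)"])
      (simp add: green_00_square cpoly_odd_poly cpoly_shift_coeff_poly)
  have recip: "boundary_dominated (\<lambda>z. - 1 / green b 0 0 z)"
    using real_rooted_odd_poly rsquarefree_odd_poly
    by (rule boundary_dominated_sqrt_quotient[where p = shift_coeff_poly])
      (simp add: green_00_square power_divide cpoly_odd_poly cpoly_shift_coeff_poly)
  show "boundary_dominated (green b 0 1)"
    by (rule boundary_dominated_cong[OF boundary_dominated_add[OF
            boundary_dominated_cpoly_mult[OF G, of ?l] boundary_dominated_cpoly[of "[:- 1:]"]]])
      (simp add: green_01)
  show "boundary_dominated (green b 1 1)"
    by (rule boundary_dominated_cong[OF boundary_dominated_add[OF
            boundary_dominated_cpoly_mult[OF G, of "?l\<^sup>2"] recip]])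
      (simp add: green_11 power2_eq_square algebra_simps)
qed

end

definition band_density :: "(real \<Rightarrow> real) \<Rightarrow> (real \<Rightarrow> real) \<Rightarrow> real \<Rightarrow> real" where
  "band_density g p x = (if (g x)\<^sup>2 < 1 then \<bar>p x\<bar> / (pi * sqrt (1 - (g x)\<^sup>2)) else 0)"

context even_periodic_potential
begin

abbreviation half_trace :: "real \<Rightarrow> real" where
  "half_trace x \<equiv> even_sol b x (int N)"

abbreviation first_kind_poly :: "int \<Rightarrow> real poly" where
  "first_kind_poly n \<equiv> even_poly n + ([:0, 1:] - bp 0) * odd_poly n"

lemma cpoly_first_kind_poly:
  "cpoly (first_kind_poly n) z = even_sol bc z n + (z - b 0) * odd_sol bc z n"
  unfolding cpoly_add cpoly_mult cpoly_hom.hom_diff by (simp add: cpoly_even_poly cpoly_odd_poly)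

lemma green_squares_eq_cpoly:
  assumes z: "Im z > 0"
  shows "(green b 0 0 z)\<^sup>2 =
      (cpoly (odd_poly (int N)) z)\<^sup>2 / cpoly ((even_poly (int N))\<^sup>2 - 1) z"
    and "(green b 1 1 z)\<^sup>2 =
      (cpoly (first_kind_poly (int N - 1)) z)\<^sup>2 / cpoly ((even_poly (int N))\<^sup>2 - 1) z"
proof -
  have nonreal: "Im z \<noteq> 0" using z by simp
  have denominator: "cpoly ((even_poly (int N))\<^sup>2 - 1) z =
      even_shift_coeff bc N z * odd_sol bc z (int N)"
    unfolding poly.even_sol_square_minus_1 by (simp add: cpoly_odd_poly cpoly_shift_coeff_poly)
  show "(green b 0 0 z)\<^sup>2 =
      (cpoly (odd_poly (int N)) z)\<^sup>2 / cpoly ((even_poly (int N))\<^sup>2 - 1) z"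
    unfolding green_00_square[OF nonreal] denominator cpoly_odd_poly
    using odd_sol_period_nonzero[OF nonreal] by (simp add: power2_eq_square)
  show "(green b 1 1 z)\<^sup>2 =
      (cpoly (first_kind_poly (int N - 1)) z)\<^sup>2 / cpoly ((even_poly (int N))\<^sup>2 - 1) z"
    unfolding green_11_square[OF nonreal] denominator cpoly_first_kind_poly
      complex.even_sol_square_minus_1 ..
qed

lemma green_boundary_values:
  assumes x: "(half_trace x)\<^sup>2 \<noteq> 1"
  shows "((\<lambda>y. - Im (green b 0 0 (Complex x y)) / pi) \<longlongrightarrow>
      band_density half_trace (poly (odd_poly (int N))) x) (at_right 0)"
    and "((\<lambda>y. - Im (green b 0 1 (Complex x y)) / pi) \<longlongrightarrow>
      (x - b 0) * band_density half_trace (poly (odd_poly (int N))) x) (at_right 0)"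
    and "((\<lambda>y. - Im (green b 1 1 (Complex x y)) / pi) \<longlongrightarrow>
      band_density half_trace (poly (first_kind_poly (int N - 1))) x) (at_right 0)"
proof -
  let ?q = "(even_poly (int N))\<^sup>2 - 1"
  have q: "poly ?q x = (half_trace x)\<^sup>2 - 1"
    by (simp add: poly_even_poly)
  with x have q_nonzero: "poly ?q x \<noteq> 0" by simp
  have density: "((\<lambda>y. - Im (G (Complex x y)) / pi) \<longlongrightarrow>
      band_density half_trace (poly p) x) (at_right 0)"
    if "((\<lambda>y. Im (G (Complex x y))) \<longlongrightarrow>
      - (if poly ?q x < 0 then \<bar>poly p x\<bar> / sqrt (- poly ?q x) else 0)) (at_right 0)" for G p
    using tendsto_divide[OF tendsto_minus[OF that] tendsto_const[of pi]]
    unfolding q by (cases "(half_trace x)\<^sup>2 < 1") (simp_all add: band_density_def mult.commute)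
  note boundary_value = density[OF Im_boundary_value[OF _ q_nonzero green_diag_Im_nonpos]]
  show green_00: "((\<lambda>y. - Im (green b 0 0 (Complex x y)) / pi) \<longlongrightarrow>
      band_density half_trace (poly (odd_poly (int N))) x) (at_right 0)"
    by (rule boundary_value[OF green_squares_eq_cpoly(1)])
  show "((\<lambda>y. - Im (green b 1 1 (Complex x y)) / pi) \<longlongrightarrow>
      band_density half_trace (poly (first_kind_poly (int N - 1))) x) (at_right 0)"
    by (rule boundary_value[OF green_squares_eq_cpoly(2)])
  have "((\<lambda>y. (x - b 0) * (- Im (green b 0 0 (Complex x y)) / pi) -
      y * Re (green b 0 0 (Complex x y)) / pi) \<longlongrightarrow>
      (x - b 0) * band_density half_trace (poly (odd_poly (int N))) x - 0 / pi) (at_right 0)"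
    by (intro tendsto_intros green_00
        vertical_times_Re_tendsto_0[OF green_squares_eq_cpoly(1) q_nonzero]) simp_all
  then show "((\<lambda>y. - Im (green b 0 1 (Complex x y)) / pi) \<longlongrightarrow>
      (x - b 0) * band_density half_trace (poly (odd_poly (int N))) x) (at_right 0)"
    unfolding div_0 diff_0_right
    by (rule Lim_transform_eventually)
      (use eventually_at_right_less[of 0] in eventually_elim, simp add: green_01 field_simps)
qed

lemma spectral_measure_density:
  assumes \<mu>: "is_spectral_measure (schroedinger_op b) \<mu>" "i \<in> {0, 1}" "j \<in> {0, 1}"
    and dom: "boundary_dominated (green b i j)"
    and \<rho>: "\<rho> \<in> borel_measurable borel" "\<And>x. \<rho> x \<noteq> 0 \<Longrightarrow> (half_trace x)\<^sup>2 < 1"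
    and lim: "\<And>x. (half_trace x)\<^sup>2 \<noteq> 1 \<Longrightarrow>
      ((\<lambda>y. - Im (green b i j (Complex x y)) / pi) \<longlongrightarrow> \<rho> x) (at_right 0)"
  shows "absolutely_continuous_with_density (\<mu> i j) \<rho>"
proof (rule stieltjes_density[OF _ _ dom \<rho>(1)])
  show "finite_real_measure (\<mu> i j)"
    using \<mu> unfolding is_spectral_measure_def by blast
  show "has_real_measure_integral (\<mu> i j) (\<lambda>x. 1 / (z - complex_of_real x)) (green b i j z)"
    if "z \<notin> \<real>" for z
    using \<mu> that unfolding is_spectral_measure_def green_def by blast
  have "bounded {x. \<bar>poly (even_poly (int N)) x\<bar> < 1}"
    using period_pos by (intro bounded_poly_sublevel) (simp add: degree_even_poly)
  then show "bounded {x. \<rho> x \<noteq> 0}"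
    by (rule bounded_subset) (auto simp: poly_even_poly abs_square_less_1 dest: \<rho>(2))
  have "(even_poly (int N))\<^sup>2 - 1 \<noteq> 0"
    unfolding poly.even_sol_square_minus_1
    using rsquarefree_shift_coeff_poly rsquarefree_odd_poly by (simp add: rsquarefree_def)
  from AE_poly_nonzero[OF this]
  show "AE x in lborel. ((\<lambda>y. - Im (green b i j (Complex x y)) / pi) \<longlongrightarrow> \<rho> x) (at_right 0)"
    by eventually_elim (rule lim, simp add: poly_even_poly)
qed

theorem spectral_measure_absolutely_continuous:
  assumes "is_spectral_measure (schroedinger_op b) \<mu>"
  shows "absolutely_continuous_with_density (\<mu> 0 0)
      (band_density half_trace (poly (odd_poly (int N))))"
    and "absolutely_continuous_with_density (\<mu> 0 1)
      (\<lambda>x. (x - b 0) * band_density half_trace (poly (odd_poly (int N))) x)"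
    and "absolutely_continuous_with_density (\<mu> 1 1)
      (band_density half_trace (poly (first_kind_poly (int N - 1))))"
proof -
  have poly_measurable: "poly p \<in> borel_measurable borel" for p :: "real poly"
    by (intro borel_measurable_continuous_onI continuous_intros)
  then have [measurable]: "band_density half_trace (poly p) \<in> borel_measurable borel" for p
    unfolding band_density_def poly_even_poly[symmetric] by measurable
  have support: "band_density half_trace (poly p) x \<noteq> 0 \<Longrightarrow> (half_trace x)\<^sup>2 < 1" for p x
    by (simp add: band_density_def split: if_splits)
  note density = spectral_measure_density[OF assms]
  show "absolutely_continuous_with_density (\<mu> 0 0)
      (band_density half_trace (poly (odd_poly (int N))))"
    by (rule density[OF _ _ boundary_dominated_green(1) _ support green_boundary_values(1)])
      simp_all
  show "absolutely_continuous_with_density (\<mu> 0 1)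
      (\<lambda>x. (x - b 0) * band_density half_trace (poly (odd_poly (int N))) x)"
    by (rule density[OF _ _ boundary_dominated_green(2) _ _ green_boundary_values(2)])
      (auto dest: support)
  show "absolutely_continuous_with_density (\<mu> 1 1)
      (band_density half_trace (poly (first_kind_poly (int N - 1))))"
    by (rule density[OF _ _ boundary_dominated_green(3) _ support green_boundary_values(3)])
      simp_all
qed

end

section \<open>The bands\<close>

lemma prod_pairs: "(\<Prod>i\<in>{1..2 * n}. f i) = (\<Prod>k\<in>{1..n}. f (2 * k - 1) * f (2 * k))"
  for f :: "nat \<Rightarrow> 'a::comm_monoid_mult"
proof (induction n)
  case (Suc n)
  have "{1..2 * Suc n} = insert (2 * n + 2) (insert (2 * n + 1) {1..2 * n})" by auto
  then show ?case using Suc by (simp add: mult_ac)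
qed simp

lemma bands_separated:
  fixes \<xi> :: "nat \<Rightarrow> real"
  assumes lt: "\<And>k. k \<in> {1..N} \<Longrightarrow> \<xi> (2 * k - 1) < \<xi> (2 * k)"
    and le: "\<And>k. k \<in> {1..<N} \<Longrightarrow> \<xi> (2 * k) \<le> \<xi> (2 * k + 1)"
    and "1 \<le> j" "j < k" "k \<le> N"
  shows "\<xi> (2 * j) \<le> \<xi> (2 * k - 1)"
  using \<open>j < k\<close> \<open>k \<le> N\<close>
proof (induction k)
  case (Suc k)
  have gap: "\<xi> (2 * k) \<le> \<xi> (2 * Suc k - 1)"
    using le[of k] Suc.prems \<open>1 \<le> j\<close> by simp
  show ?case
  proof (cases "j = k")
    case False
    then have "\<xi> (2 * j) \<le> \<xi> (2 * k - 1)" using Suc by simp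
    also have "\<dots> < \<xi> (2 * k)" using lt[of k] Suc.prems \<open>1 \<le> j\<close> by simp
    finally show ?thesis using gap by simp
  qed (use gap in simp)
qed simp

lemma prod_neg_in_band:
  fixes \<xi> :: "nat \<Rightarrow> real"
  assumes lt: "\<And>k. k \<in> {1..N} \<Longrightarrow> \<xi> (2 * k - 1) < \<xi> (2 * k)"
    and le: "\<And>k. k \<in> {1..<N} \<Longrightarrow> \<xi> (2 * k) \<le> \<xi> (2 * k + 1)"
    and k: "k \<in> {1..N}" "\<xi> (2 * k - 1) < x" "x < \<xi> (2 * k)"
  shows "(\<Prod>i\<in>{1..2 * N}. x - \<xi> i) < 0"
proof -
  let ?f = "\<lambda>j. (x - \<xi> (2 * j - 1)) * (x - \<xi> (2 * j))"
  note separated = bands_separated[of N \<xi>, OF lt le]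
  have "?f j > 0" if j: "j \<in> {1..N} - {k}" for j
  proof (cases "j < k")
    case True
    then show ?thesis
      using separated[of j k] lt[of j] j k by (intro mult_pos_pos) auto
  next
    case False
    then show ?thesis
      using separated[of k j] lt[of j] j k by (intro mult_neg_neg) auto
  qed
  then have "(\<Prod>j\<in>{1..N} - {k}. ?f j) > 0" by (intro prod_pos) blast
  moreover have "?f k < 0" using k by (intro mult_pos_neg) auto
  ultimately have "?f k * (\<Prod>j\<in>{1..N} - {k}. ?f j) < 0" by (rule mult_neg_pos[rotated])
  then show ?thesis
    unfolding prod_pairs using prod.remove[of "{1..N}" k ?f] k by simp
qed

lemma prod_nonneg_outside_bands:
  fixes \<xi> :: "nat \<Rightarrow> real"
  assumes lt: "\<And>k. k \<in> {1..N} \<Longrightarrow> \<xi> (2 * k - 1) < \<xi> (2 * k)"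
    and x: "x \<notin> (\<Union>k\<in>{1..N}. {\<xi> (2 * k - 1)<..<\<xi> (2 * k)})"
  shows "(\<Prod>i\<in>{1..2 * N}. x - \<xi> i) \<ge> 0"
proof -
  have "(x - \<xi> (2 * k - 1)) * (x - \<xi> (2 * k)) \<ge> 0" if "k \<in> {1..N}" for k
    using x that lt[OF that] by (force simp: zero_le_mult_iff not_less)
  then show ?thesis
    unfolding prod_pairs by (intro prod_nonneg) blast
qed

lemma union_bands_eq_poly_neg:
  fixes p :: "real poly" and \<xi> :: "nat \<Rightarrow> real"
  assumes "proots p = image_mset \<xi> (mset_set {1..2 * N})" "degree p = 2 * N" "lead_coeff p > 0"
    and "\<And>k. k \<in> {1..N} \<Longrightarrow> \<xi> (2 * k - 1) < \<xi> (2 * k)"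
    and "\<And>k. k \<in> {1..<N} \<Longrightarrow> \<xi> (2 * k) \<le> \<xi> (2 * k + 1)"
  shows "(\<Union>k\<in>{1..N}. {\<xi> (2 * k - 1)<..<\<xi> (2 * k)}) = {x. poly p x < 0}"
proof -
  have "p = smult (lead_coeff p) (\<Prod>r\<in>#proots p. [:- r, 1:])"
    by (rule poly_eq_prod_proots) (simp add: assms(1,2))
  also have "(\<Prod>r\<in>#proots p. [:- r, 1:]) = (\<Prod>i\<in>{1..2 * N}. [:- \<xi> i, 1:])"
    by (simp add: assms(1) image_mset.compositionality o_def prod_unfold_prod_mset)
  finally have factored: "p = smult (lead_coeff p) (\<Prod>i\<in>{1..2 * N}. [:- \<xi> i, 1:])" .
  have "poly p x = lead_coeff p * (\<Prod>i\<in>{1..2 * N}. x - \<xi> i)" for x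
    by (subst factored) (simp add: poly_prod)
  then have neg_iff: "poly p x < 0 \<longleftrightarrow> (\<Prod>i\<in>{1..2 * N}. x - \<xi> i) < 0" for x
    using assms(3) by (simp add: mult_less_0_iff)
  show ?thesis
  proof (intro set_eqI iffI)
    fix x assume "x \<in> (\<Union>k\<in>{1..N}. {\<xi> (2 * k - 1)<..<\<xi> (2 * k)})"
    then show "x \<in> {x. poly p x < 0}"
      using prod_neg_in_band[of N \<xi> _ x, OF assms(4,5)] by (auto simp: neg_iff)
  next
    fix x assume "x \<in> {x. poly p x < 0}"
    then show "x \<in> (\<Union>k\<in>{1..N}. {\<xi> (2 * k - 1)<..<\<xi> (2 * k)})"
      using prod_nonneg_outside_bands[of N \<xi> x, OF assms(4)] unfolding neg_iff by fastforce
  qed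
qed

lemma degree_lead_coeff_square_minus_1:
  fixes p :: "real poly"
  assumes "degree p > 0"
  shows "degree (p\<^sup>2 - 1) = 2 * degree p" "lead_coeff (p\<^sup>2 - 1) > 0"
proof -
  have "p \<noteq> 0" using assms by auto
  then have degree: "degree (p\<^sup>2) = 2 * degree p"
    by (simp add: degree_power_eq)
  then show "degree (p\<^sup>2 - 1) = 2 * degree p"
    using degree_add_eq_left[of "- 1" "p\<^sup>2"] assms by simp
  have "lead_coeff (p\<^sup>2 - 1) = lead_coeff (p\<^sup>2)"
    using lead_coeff_add_le[of "- 1" "p\<^sup>2"] degree assms by simp
  also have "\<dots> = (lead_coeff p)\<^sup>2"
    by (rule lead_coeff_power)
  finally have "lead_coeff (p\<^sup>2 - 1) = (lead_coeff p)\<^sup>2" .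
  then show "lead_coeff (p\<^sup>2 - 1) > 0"
    using \<open>p \<noteq> 0\<close> by simp
qed

section \<open>The cosine potential\<close>

lemma jacobi_op_eq_schroedinger_op: "jacobi_op a N = schroedinger_op (jacobi_diag a N)"
  by (intro ext) (simp add: jacobi_op_apply schroedinger_op_def)

lemma even_periodic_potential_jacobi_diag:
  assumes "N \<ge> 1"
  shows "even_periodic_potential (jacobi_diag a N) N"
proof
  fix n
  have "2 * real_of_int (n + int N) * pi / real N = 2 * real_of_int n * pi / real N + 2 * pi"
    using assms by (simp add: field_simps)
  then show "jacobi_diag a N (n + int N) = jacobi_diag a N n"
    unfolding jacobi_diag_def by (simp only: cos_periodic)
qed (use assms in \<open>auto simp: jacobi_diag_def\<close>)

lemma linear_factor_eq: "[:- 2 * c, 2:] = 2 * ([:0, 1:] - [:c:] :: real poly)"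
  by (simp add: numeral_poly)

context
  fixes a :: real and N :: nat
  assumes N: "N \<ge> 1"
begin

interpretation even_periodic_potential "jacobi_diag a N" N
  by (rule even_periodic_potential_jacobi_diag[OF N])

lemma Pstar_eq_odd_poly: "Pstar a N n = 2 * odd_poly (int n)"
proof (induction n rule: induct_nat_012)
  case (ge2 n)
  show ?case
    unfolding Pstar.simps linear_factor_eq ge2 solution_Suc_Suc[OF is_solution_odd_sol]
    by (simp only: algebra_simps)
qed (simp_all add: numeral_poly)

lemma Ppoly_eq_first_kind_poly: "Ppoly a N n = first_kind_poly (int n)"
proof (induction n rule: induct_nat_012)
  case (ge2 n)
  show ?case
    unfolding Ppoly.simps linear_factor_eq ge2
      solution_Suc_Suc[OF is_solution_odd_sol] solution_Suc_Suc[OF is_solution_even_sol]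
    by (simp only: algebra_simps)
qed (simp_all add: jacobi_diag_def one_pCons)

lemma gN_poly_eq_even_poly: "gN_poly a N = even_poly (int N)"
proof -
  have half: "smult (1/2) (2 * p) = p" for p :: "real poly"
    by (simp add: numeral_poly)
  have "gN_poly a N = smult (1/2) (first_kind_poly (int N) - odd_poly (int N - 1))"
    using N by (simp add: gN_poly_def Ppoly_eq_first_kind_poly Pstar_eq_odd_poly half of_nat_diff)
  also have "first_kind_poly (int N) - odd_poly (int N - 1) = 2 * even_poly (int N)"
    unfolding poly.odd_sol_pred_period by (simp only: algebra_simps)
  finally show ?thesis by (simp only: half)
qed

end

theorem theorem7p3:
  fixes N :: nat and a :: real
    and \<xi> :: "nat \<Rightarrow> real"
    and \<mu> :: "int \<Rightarrow> int \<Rightarrow> real set \<Rightarrow> real"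
  defines "U \<equiv> (\<Union>k\<in>{1..N}. {\<xi> (2 * k - 1)<..<\<xi> (2 * k)})"
    and "g \<equiv> poly (gN_poly a N)"
  assumes "N \<ge> 1" and "a > 0"
    and roots: "proots ((gN_poly a N)\<^sup>2 - 1) = image_mset \<xi> (mset_set {1..2 * N})"
    and "\<And>k. k \<in> {1..N} \<Longrightarrow> \<xi> (2 * k - 1) < \<xi> (2 * k)"
    and "\<And>k. k \<in> {1..<N} \<Longrightarrow> \<xi> (2 * k) \<le> \<xi> (2 * k + 1)"
    and spectral: "is_spectral_measure (jacobi_op a N) \<mu>"
  shows "absolutely_continuous_with_density (\<mu> 0 0)
           (\<lambda>x. if x \<in> U then \<bar>poly (Pstar a N N) x\<bar> / (2 * pi * sqrt (1 - (g x)\<^sup>2)) else 0) \<and>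
         absolutely_continuous_with_density (\<mu> 0 1)
           (\<lambda>x. if x \<in> U then (x - a) * \<bar>poly (Pstar a N N) x\<bar> / (2 * pi * sqrt (1 - (g x)\<^sup>2)) else 0) \<and>
         absolutely_continuous_with_density (\<mu> 1 1)
           (\<lambda>x. if x \<in> U then \<bar>poly (Ppoly a N (N - 1)) x\<bar> / (pi * sqrt (1 - (g x)\<^sup>2)) else 0)"
proof -
  interpret even_periodic_potential "jacobi_diag a N" N
    by (rule even_periodic_potential_jacobi_diag[OF \<open>N \<ge> 1\<close>])
  have g_eq: "g x = half_trace x" for x
    by (simp add: g_def gN_poly_eq_even_poly[OF \<open>N \<ge> 1\<close>] poly_even_poly)
  have "degree (gN_poly a N) = N"
    by (simp only: gN_poly_eq_even_poly[OF \<open>N \<ge> 1\<close>] degree_even_poly)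
  then have "U = {x. poly ((gN_poly a N)\<^sup>2 - 1) x < 0}"
    unfolding U_def using degree_lead_coeff_square_minus_1[of "gN_poly a N"] assms(3,6,7)
    by (intro union_bands_eq_poly_neg[OF roots]) simp_all
  then have U_iff: "x \<in> U \<longleftrightarrow> (half_trace x)\<^sup>2 < 1" for x
    using g_eq by (simp add: g_def)
  have diag_0: "jacobi_diag a N 0 = a"
    by (simp add: jacobi_diag_def)
  have pred: "int N - 1 = int (N - 1)"
    using \<open>N \<ge> 1\<close> by simp
  show ?thesis
    using spectral_measure_absolutely_continuous[OF spectral[unfolded jacobi_op_eq_schroedinger_op]]
    unfolding band_density_def U_iff g_eq pred diag_0
      Pstar_eq_odd_poly[OF \<open>N \<ge> 1\<close>] Ppoly_eq_first_kind_poly[OF \<open>N \<ge> 1\<close>]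
    by (simp add: abs_mult if_distrib cong: if_cong)
qed

end
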